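(* Fix a finite abelian group $A$ with $|A|\ge 5$. If there exists a $2$-edge-connected (multi)graph that is not $A$-flow-connected, then there exists a simple, $2$-connected, $3$-edge-connected cubic graph $G$ that is not $A$-flow-connected.
   Context: Graphs are finite. A cycle is a connected 2-regular graph (two parallel edges form a cycle of length 2). Fix an arbitrary orientation $D$ of a graph $G$; for a vertex $v$ let $E_D^+(v)$ and $E_D^-(v)$ be the sets of edges directed out of and into $v$. An $A$-flow on $G$ (always nowhere-zero here) is a function $f:E(G)\to A\setminus\{0_A\}$ with $\sum_{e\in E_D^+(v)}f(e)-\sum_{e\in E_D^-(v)}f(e)=0_A$ for every vertex $v$. (Flows given with different orientations are identified by negating the value of every edge whose orientation is reversed, so the choice of $D$ does not matter.) Two $A$-flows $f',f''$ are adjacent if there is a cycle $C$ in $G$ such that $f'(e)=f''(e)$ for all $e\notin E(C)$, and equivalent if they are joined by a finite sequence of $A$-flows in which consecutive flows are adjacent. $G$ is $A$-flow-connected if all its $A$-flows are pairwise equivalent (vacuously true if $G$ has no $A$-flow). *)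

theory Defs
  imports "Graph_Theory.Digraph" "HOL-Library.Cardinality" "HOL-Library.FuncSet"
begin

section \<open>Finite undirected multigraphs\<close>

text \<open>
  Edges are abstract objects, so parallel edges are distinct edges with the same set of ends.
  A loop at \<open>v\<close> is an edge \<open>e\<close> with \<open>ends G e = {v}\<close>. The value of \<open>ends G\<close> outside
  \<open>edges G\<close> is irrelevant.
\<close>

record ('v, 'e) mgraph =
  vertices :: "'v set"
  edges :: "'e set"
  ends :: "'e \<Rightarrow> 'v set"

definition multigraph :: "('v, 'e) mgraph \<Rightarrow> bool" where
  "multigraph G \<longleftrightarrow> finite (vertices G) \<and> finite (edges G) \<and>
     (\<forall>e\<in>edges G. ends G e \<subseteq> vertices G \<and> card (ends G e) \<in> {1, 2})"

definition simple_mgraph :: "('v, 'e) mgraph \<Rightarrow> bool" where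
  "simple_mgraph G \<longleftrightarrow> (\<forall>e\<in>edges G. card (ends G e) = 2) \<and> inj_on (ends G) (edges G)"

text \<open>A loop contributes two to the degree.\<close>

definition degree :: "('v, 'e) mgraph \<Rightarrow> 'v \<Rightarrow> nat" where
  "degree G v = card {e \<in> edges G. v \<in> ends G e} + card {e \<in> edges G. ends G e = {v}}"

definition regular_mgraph :: "nat \<Rightarrow> ('v, 'e) mgraph \<Rightarrow> bool" where
  "regular_mgraph d G \<longleftrightarrow> (\<forall>v\<in>vertices G. degree G v = d)"

abbreviation cubic :: "('v, 'e) mgraph \<Rightarrow> bool" where
  "cubic \<equiv> regular_mgraph 3"

definition subgraph_of :: "('v, 'e) mgraph \<Rightarrow> ('v, 'e) mgraph \<Rightarrow> bool" where
  "subgraph_of H G \<longleftrightarrow> multigraph H \<and> vertices H \<subseteq> vertices G \<and> edges H \<subseteq> edges G \<and>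
     (\<forall>e\<in>edges H. ends H e = ends G e)"

definition adj_rel :: "('v, 'e) mgraph \<Rightarrow> ('v \<times> 'v) set" where
  "adj_rel G = {(u, v). \<exists>e\<in>edges G. ends G e = {u, v}}"

text \<open>The graph without vertices is not connected.\<close>

definition connected_mgraph :: "('v, 'e) mgraph \<Rightarrow> bool" where
  "connected_mgraph G \<longleftrightarrow> vertices G \<noteq> {} \<and>
     (\<forall>u\<in>vertices G. \<forall>v\<in>vertices G. (u, v) \<in> (adj_rel G)\<^sup>*)"

definition delete_edges :: "('v, 'e) mgraph \<Rightarrow> 'e set \<Rightarrow> ('v, 'e) mgraph" where
  "delete_edges G F = G\<lparr>edges := edges G - F\<rparr>"

definition delete_vertices :: "('v, 'e) mgraph \<Rightarrow> 'v set \<Rightarrow> ('v, 'e) mgraph" where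
  "delete_vertices G X =
     G\<lparr>vertices := vertices G - X, edges := {e \<in> edges G. ends G e \<inter> X = {}}\<rparr>"

text \<open>
  A one-vertex graph counts as \<open>k\<close>-edge-connected for every \<open>k\<close>, whereas a \<open>k\<close>-connected
  graph must have more than \<open>k\<close> vertices.
\<close>

definition edge_connected :: "nat \<Rightarrow> ('v, 'e) mgraph \<Rightarrow> bool" where
  "edge_connected k G \<longleftrightarrow>
     (\<forall>F. F \<subseteq> edges G \<and> card F < k \<longrightarrow> connected_mgraph (delete_edges G F))"

definition vertex_connected :: "nat \<Rightarrow> ('v, 'e) mgraph \<Rightarrow> bool" where
  "vertex_connected k G \<longleftrightarrow> card (vertices G) > k \<and>
     (\<forall>X. X \<subseteq> vertices G \<and> card X < k \<longrightarrow> connected_mgraph (delete_vertices G X))"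

text \<open>A loop is a cycle of length one, two parallel edges form a cycle of length two.\<close>

definition is_cycle :: "('v, 'e) mgraph \<Rightarrow> bool" where
  "is_cycle C \<longleftrightarrow> multigraph C \<and> connected_mgraph C \<and> regular_mgraph 2 C"


section \<open>Nowhere-zero flows\<close>

definition orientation :: "('v, 'e) mgraph \<Rightarrow> ('v, 'e) pre_digraph \<Rightarrow> bool" where
  "orientation G D \<longleftrightarrow> verts D = vertices G \<and> arcs D = edges G \<and>
     (\<forall>e\<in>edges G. {tail D e, head D e} = ends G e)"

text \<open>
  Flows are functions on the edge set only: they are \<^term>\<open>undefined\<close> elsewhere, so that
  two flows are equal iff they agree on all edges.
\<close>

definition flows :: "('v, 'e) pre_digraph \<Rightarrow> ('e \<Rightarrow> 'a::ab_group_add) set" where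
  "flows D = {f \<in> arcs D \<rightarrow>\<^sub>E UNIV - {0}.
     \<forall>v\<in>verts D. (\<Sum>e\<in>out_arcs D v. f e) - (\<Sum>e\<in>in_arcs D v. f e) = 0}"

definition adjacent_flows :: "('v, 'e) mgraph \<Rightarrow> ('e \<Rightarrow> 'a) \<Rightarrow> ('e \<Rightarrow> 'a) \<Rightarrow> bool" where
  "adjacent_flows G f g \<longleftrightarrow>
     (\<exists>C. is_cycle C \<and> subgraph_of C G \<and> (\<forall>e\<in>edges G - edges C. f e = g e))"

definition equivalent_flows ::
  "('v, 'e) mgraph \<Rightarrow> ('v, 'e) pre_digraph \<Rightarrow> ('e \<Rightarrow> 'a::ab_group_add) \<Rightarrow> ('e \<Rightarrow> 'a) \<Rightarrow> bool"
  where
  "equivalent_flows G D =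
     (\<lambda>f g. f \<in> flows D \<and> g \<in> flows D \<and> adjacent_flows G f g)\<^sup>*\<^sup>*"

definition flow_connected_wrt ::
  "'a::ab_group_add itself \<Rightarrow> ('v, 'e) mgraph \<Rightarrow> ('v, 'e) pre_digraph \<Rightarrow> bool" where
  "flow_connected_wrt _ G D \<longleftrightarrow>
     (\<forall>f\<in>flows D. \<forall>g\<in>flows D. equivalent_flows G D f (g :: 'e \<Rightarrow> 'a))"

text \<open>
  The abelian group is the type \<open>'a\<close>. Every multigraph has an orientation and the choice of
  orientation does not matter: \<open>orientation_exists\<close>, \<open>flow_connected_wrt_cong\<close>.
\<close>

definition flow_connected :: "'a::ab_group_add itself \<Rightarrow> ('v, 'e) mgraph \<Rightarrow> bool" where
  "flow_connected A G \<longleftrightarrow> (\<forall>D. orientation G D \<longrightarrow> flow_connected_wrt A G D)"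

lemma orientation_exists:
  assumes "multigraph G"
  shows "\<exists>D. orientation G D"
proof -
  have "\<exists>p. {fst p, snd p} = ends G e" if "e \<in> edges G" for e
  proof -
    have "card (ends G e) = 1 \<or> card (ends G e) = 2"
      using assms that by (auto simp: multigraph_def)
    then obtain x y where "ends G e = {x, y}"
      by (metis card_1_singletonE card_2_iff insert_absorb2)
    then show ?thesis by (metis fst_conv snd_conv)
  qed
  then obtain p where "\<And>e. e \<in> edges G \<Longrightarrow> {fst (p e), snd (p e)} = ends G e"
    by metis
  then have "orientation G \<lparr>verts = vertices G, arcs = edges G, tail = fst \<circ> p, head = snd \<circ> p\<rparr>"
    by (auto simp: orientation_def)
  then show ?thesis by blast
qed

definition reorient ::
  "('v, 'e) pre_digraph \<Rightarrow> ('v, 'e) pre_digraph \<Rightarrow> ('e \<Rightarrow> 'a::ab_group_add) \<Rightarrow> 'e \<Rightarrow> 'a" where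
  "reorient D D' f = (\<lambda>e. if e \<in> arcs D \<and> tail D e \<noteq> tail D' e then - f e else f e)"

lemma reorient_flow:
  fixes f :: "'e \<Rightarrow> 'a::ab_group_add"
  assumes G: "multigraph G" and D: "orientation G D" and D': "orientation G D'"
    and f: "f \<in> flows D"
  shows "reorient D D' f \<in> flows D'"
proof -
  have fin: "finite (edges G)" using G by (simp add: multigraph_def)
  have arcs: "arcs D = edges G" "arcs D' = edges G" "verts D = vertices G" "verts D' = vertices G"
    using D D' by (auto simp: orientation_def)
  have net: "(\<Sum>e\<in>out_arcs X v. h e) - (\<Sum>e\<in>in_arcs X v. h e) =
      (\<Sum>e\<in>edges G. (if tail X e = v then h e else 0) - (if head X e = v then h e else 0))"
    if "arcs X = edges G" for X :: "('v, 'e) pre_digraph" and v and h :: "'e \<Rightarrow> 'a"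
    unfolding sum_subtractf using that fin
    by (simp add: sum.inter_filter [symmetric] out_arcs_def in_arcs_def)
  have "(\<Sum>e\<in>out_arcs D' v. reorient D D' f e) - (\<Sum>e\<in>in_arcs D' v. reorient D D' f e) =
      (\<Sum>e\<in>out_arcs D v. f e) - (\<Sum>e\<in>in_arcs D v. f e)" for v
    unfolding net[OF arcs(1)] net[OF arcs(2)]
  proof (rule sum.cong[OF refl])
    fix e assume e: "e \<in> edges G"
    have "{tail D e, head D e} = {tail D' e, head D' e}"
      using D D' e by (auto simp: orientation_def)
    then show "(if tail D' e = v then reorient D D' f e else 0) -
        (if head D' e = v then reorient D D' f e else 0) =
        (if tail D e = v then f e else 0) - (if head D e = v then f e else 0)"
      using e arcs by (auto simp: reorient_def doubleton_eq_iff)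
  qed
  moreover have "reorient D D' f \<in> arcs D' \<rightarrow>\<^sub>E UNIV - {0}"
    using f arcs by (auto simp: flows_def reorient_def PiE_iff extensional_def)
  ultimately show ?thesis
    using f unfolding flows_def mem_Collect_eq arcs by metis
qed

lemma flow_connected_wrt_cong:
  fixes A :: "'a::ab_group_add itself" and G :: "('v, 'e) mgraph"
  assumes G: "multigraph G" and D: "orientation G D" and D': "orientation G D'"
  shows "flow_connected_wrt A G D \<longleftrightarrow> flow_connected_wrt A G D'"
proof -
  have *: "flow_connected_wrt A G E'"
    if E: "orientation G E" and E': "orientation G E'" and c: "flow_connected_wrt A G E" for E E' :: "('v, 'e) pre_digraph"
    unfolding flow_connected_wrt_def
  proof (intro ballI)
    fix f g :: "'e \<Rightarrow> 'a" assume fg: "f \<in> flows E'" "g \<in> flows E'"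
    have arcs: "arcs E = arcs E'" using E E' by (simp add: orientation_def)
    have inv: "reorient E E' (reorient E' E h) = h" for h :: "'e \<Rightarrow> 'a"
      using arcs by (intro ext) (auto simp: reorient_def)
    have "equivalent_flows G E (reorient E' E f) (reorient E' E g)"
      using c fg reorient_flow[OF G E' E] by (auto simp: flow_connected_wrt_def)
    then have "equivalent_flows G E' (reorient E E' (reorient E' E f)) (reorient E E' (reorient E' E g))"
      unfolding equivalent_flows_def
    proof (induction rule: rtranclp_induct)
      case (step h k)
      have "adjacent_flows G (reorient E E' h) (reorient E E' k)"
        using step(2) unfolding adjacent_flows_def reorient_def by fastforce
      then show ?case
        using step reorient_flow[OF G E E']
        by (metis (mono_tags, lifting) rtranclp.rtrancl_into_rtrancl)
    qed simp
    then show "equivalent_flows G E' f g" by (simp add: inv)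
  qed
  show ?thesis using *[OF D D'] *[OF D' D] by blast
qed

end

theory Submission
  imports Defs
begin

text \<open>
  Given a graph that is not flow-connected, the aim is to change it step by step into a cubic one
  without gaining flow-connectedness. What makes the steps easy is an algebraic description of
  equivalence that no longer mentions cycles. A change along a cycle adds a constant \<open>x\<close>
  to the flow along a circulation with values in \<open>{-1, 0, 1}\<close>; conversely every integer
  circulation \<open>c\<close> with these values decomposes into directed cycles, and since each edge changes
  only once, adding \<open>c \<cdot> x\<close> cycle by cycle keeps all values nonzero. Hence two flows are
  equivalent iff they are joined by moves \<open>f \<mapsto> f + c \<cdot> x\<close>
  (\<open>flow_connected_wrt_iff_linked_flows\<close>). Circulations, unlike cycles, behave well under
  contraction: restricting one to the remaining edges again gives a circulation.

  The three reductions are then of one kind (\<open>linked_flows_transfer\<close>). A loop may carry any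
  nonzero value. If two edges form a cut, each determines the value of the other up to sign, so
  one of them can be contracted. These two reductions terminate in a loopless 3-edge-connected
  graph. In such a graph a vertex \<open>v\<close> of degree at least four is expanded: it becomes a vertex of
  a 4-cycle, and the other three vertices of this cycle each take over one edge at \<open>v\<close>. The
  values on the 4-cycle are determined by one of them, which has to avoid at most four elements of
  the group; this is where \<open>|A| \<ge> 5\<close> enters. The new graph has four more edges and three more
  vertices, so \<open>2|E| - 3|V|\<close>, which is nonnegative, drops by one. It is again
  3-edge-connected unless the three chosen edges form an edge cut. Two triples of edges at
  \<open>v\<close> with two common members cannot both be such cuts, because the symmetric difference would be an edge cut of size two (\<open>ex_three_arcs_not_a_cut\<close>).

  In the resulting loopless cubic 3-edge-connected graph, two parallel edges leave a cut of
  size at most two around their ends unless there are no further vertices. The graph with two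
  vertices and three parallel edges is flow-connected, so the graph is simple. A cut
  vertex would have to send three edges to each of two sides.
\<close>

section \<open>Boundaries and circulations\<close>

text \<open>
  Sums are taken over all edges rather than over the edges at a vertex, so that linearity is
  immediate and sums over vertex sets can be exchanged. A loop contributes zero.
\<close>

definition boundary :: "('v, 'e) pre_digraph \<Rightarrow> ('e \<Rightarrow> 'b::ab_group_add) \<Rightarrow> 'v \<Rightarrow> 'b" where
  "boundary D f v =
     (\<Sum>e\<in>arcs D. (if tail D e = v then f e else 0) - (if head D e = v then f e else 0))"

definition circulation :: "('v, 'e) pre_digraph \<Rightarrow> ('e \<Rightarrow> 'b::ab_group_add) \<Rightarrow> bool" where
  "circulation D f \<longleftrightarrow> (\<forall>v\<in>verts D. boundary D f v = 0)"

definition nz_flow :: "('v, 'e) pre_digraph \<Rightarrow> ('e \<Rightarrow> 'b::ab_group_add) \<Rightarrow> bool" where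
  "nz_flow D f \<longleftrightarrow> circulation D f \<and> (\<forall>e\<in>arcs D. f e \<noteq> 0)"

definition cut :: "('v, 'e) pre_digraph \<Rightarrow> 'v set \<Rightarrow> 'e set" where
  "cut D X = {e \<in> arcs D. (tail D e \<in> X) \<noteq> (head D e \<in> X)}"

lemma boundary_cong:
  "(\<And>e. e \<in> arcs D \<Longrightarrow> f e = g e) \<Longrightarrow> boundary D f v = boundary D g v"
  unfolding boundary_def by (rule sum.cong) auto

lemma circulation_cong:
  "(\<And>e. e \<in> arcs D \<Longrightarrow> f e = g e) \<Longrightarrow> circulation D f = circulation D g"
  unfolding circulation_def using boundary_cong[of D f g] by simp

lemma nz_flow_cong:
  "(\<And>e. e \<in> arcs D \<Longrightarrow> f e = g e) \<Longrightarrow> nz_flow D f = nz_flow D g"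
  unfolding nz_flow_def using circulation_cong[of D f g] by simp

lemma boundary_add: "boundary D (\<lambda>e. f e + g e) v = boundary D f v + boundary D g v"
  unfolding boundary_def sum.distrib[symmetric] by (rule sum.cong) auto

lemma boundary_diff: "boundary D (\<lambda>e. f e - g e) v = boundary D f v - boundary D g v"
  unfolding boundary_def sum_subtractf[symmetric] by (rule sum.cong) auto

lemma circulation_add: "circulation D f \<Longrightarrow> circulation D g \<Longrightarrow> circulation D (\<lambda>e. f e + g e)"
  by (simp add: circulation_def boundary_add)

lemma circulation_diff: "circulation D f \<Longrightarrow> circulation D g \<Longrightarrow> circulation D (\<lambda>e. f e - g e)"
  by (simp add: circulation_def boundary_diff)

lemma boundary_single_arc:
  assumes "finite (arcs D)" "e \<in> arcs D"
  shows "boundary D (\<lambda>e'. if e' = e then x else 0) v =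
    (if tail D e = v then x else 0) - (if head D e = v then x else 0)"
proof -
  have "boundary D (\<lambda>e'. if e' = e then x else 0) v =
      (\<Sum>e'\<in>arcs D. if e' = e
        then (if tail D e = v then x else 0) - (if head D e = v then x else 0) else 0)"
    unfolding boundary_def by (rule sum.cong) auto
  then show ?thesis using assms by simp
qed

lemma sum_boundary:
  assumes "finite (arcs D)" "finite X"
  shows "(\<Sum>v\<in>X. boundary D f v) = (\<Sum>e\<in>cut D X. if tail D e \<in> X then f e else - f e)"
proof -
  have "(\<Sum>v\<in>X. boundary D f v) =
      (\<Sum>e\<in>arcs D. \<Sum>v\<in>X. (if tail D e = v then f e else 0) - (if head D e = v then f e else 0))"
    unfolding boundary_def by (rule sum.swap)
  also have "\<dots> = (\<Sum>e\<in>arcs D. if e \<in> cut D X then if tail D e \<in> X then f e else - f e else 0)"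
    using assms by (intro sum.cong) (auto simp: sum_subtractf cut_def)
  also have "\<dots> = (\<Sum>e\<in>cut D X. if tail D e \<in> X then f e else - f e)"
    using assms by (intro sum.mono_neutral_cong_right) (auto simp: cut_def)
  finally show ?thesis .
qed

text \<open>
  Summing the boundary over \<open>X\<close> cancels the edges inside \<open>X\<close>, so what remains is the net
  flow across the cut.
\<close>

lemma circulation_cut:
  assumes "fin_digraph D" "circulation D f" "X \<subseteq> verts D"
  shows "(\<Sum>e\<in>cut D X. if tail D e \<in> X then f e else - f e) = 0"
proof -
  interpret fin_digraph D by fact
  have "finite X" using assms finite_verts finite_subset by blast
  moreover have "(\<Sum>v\<in>X. boundary D f v) = 0"
    using assms by (intro sum.neutral) (auto simp: circulation_def)
  ultimately show ?thesis using sum_boundary[of D X f] by simp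
qed

text \<open>
  Integer multiples turn an integer circulation and a group element into a circulation with values
  in the group.
\<close>

definition int_scale :: "int \<Rightarrow> 'a::ab_group_add \<Rightarrow> 'a" where
  "int_scale k x = (\<Sum>i<nat k. x) - (\<Sum>i<nat (- k). x)"

lemma int_scale_simps [simp]:
  "int_scale 0 x = 0" "int_scale 1 x = x" "int_scale (- 1) x = - x"
  by (simp_all add: int_scale_def)

lemma int_scale_add: "int_scale (k + l) x = int_scale k x + int_scale l x"
proof -
  have add: "(\<Sum>i<m + n. x) = (\<Sum>i<m. x) + (\<Sum>i<n. x)" for m n :: nat
    by (induction n) (auto simp: add.assoc)
  have diff: "int_scale (int m - int n) x = (\<Sum>i<m. x) - (\<Sum>i<n. x)" for m n
  proof (cases "n \<le> m")
    case True
    then show ?thesis using add[of "m - n" n] by (simp add: int_scale_def nat_diff_distrib)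
  next
    case False
    then show ?thesis using add[of "n - m" m] by (simp add: int_scale_def nat_diff_distrib)
  qed
  obtain a b where k: "k = int a - int b" by (rule int_diff_cases)
  obtain c d where l: "l = int c - int d" by (rule int_diff_cases)
  have "k + l = int (a + c) - int (b + d)" using k l by simp
  then have "int_scale (k + l) x = (\<Sum>i<a + c. x) - (\<Sum>i<b + d. x)" using diff by metis
  also have "\<dots> = int_scale k x + int_scale l x" unfolding k l diff add by simp
  finally show ?thesis .
qed

lemma boundary_int_scale:
  "boundary D (\<lambda>e. int_scale (c e) x) v = int_scale (boundary D c v) x"
proof -
  have m: "int_scale (- k) x = - int_scale k x" for k
    using int_scale_add[of k "- k" x] by (simp add: add_eq_0_iff)
  have d: "int_scale (k - l) x = int_scale k x - int_scale l x" for k l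
    using int_scale_add[of k "- l" x] m by simp
  have "int_scale (boundary D c v) x = (\<Sum>e\<in>arcs D.
      int_scale ((if tail D e = v then c e else 0) - (if head D e = v then c e else 0)) x)"
    unfolding boundary_def
    by (subst sum_comp_morphism[where h = "\<lambda>k. int_scale k x", symmetric])
      (auto simp: int_scale_add)
  also have "\<dots> = boundary D (\<lambda>e. int_scale (c e) x) v"
    unfolding boundary_def by (rule sum.cong) (auto simp: d)
  finally show ?thesis by simp
qed

lemma circulation_int_scale: "circulation D c \<Longrightarrow> circulation D (\<lambda>e. int_scale (c e) x)"
  by (simp add: circulation_def boundary_int_scale)


section \<open>Moves along circulations\<close>

text \<open>
  The coefficients are integers and not merely signs chosen such that the sum is a flow: in a group
  element \<open>x\<close> of order three, say, three edges into a vertex balance with coefficients one, but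
  such a change need not decompose into changes along cycles.
\<close>

definition move :: "('v, 'e) pre_digraph \<Rightarrow> ('e \<Rightarrow> 'a::ab_group_add) \<Rightarrow> ('e \<Rightarrow> 'a) \<Rightarrow> bool" where
  "move D f g \<longleftrightarrow> nz_flow D f \<and> nz_flow D g \<and>
     (\<exists>(c :: 'e \<Rightarrow> int) x. circulation D c \<and> (\<forall>e\<in>arcs D. c e \<in> {- 1, 0, 1}) \<and>
        (\<forall>e\<in>arcs D. g e = f e + int_scale (c e) x))"

definition linked_flows :: "'a::ab_group_add itself \<Rightarrow> ('v, 'e) pre_digraph \<Rightarrow> bool" where
  "linked_flows _ D \<longleftrightarrow>
     (\<forall>f g :: 'e \<Rightarrow> 'a. nz_flow D f \<longrightarrow> nz_flow D g \<longrightarrow> (move D)\<^sup>*\<^sup>* f g)"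

lemma move_eq_on_arcs:
  assumes "nz_flow D f" "\<And>e. e \<in> arcs D \<Longrightarrow> g e = f e"
  shows "move D f g"
proof -
  have "nz_flow D g" using assms nz_flow_cong by metis
  then show ?thesis using assms unfolding move_def
    by (intro conjI exI[of _ "\<lambda>_. 0"] exI[of _ 0]) (auto simp: circulation_def boundary_def)
qed

lemma move_sym: 
  assumes "move D f g"
  shows "move D g f"
proof -
  obtain c x where c: "circulation D c" "\<forall>e\<in>arcs D. c e \<in> {- 1, 0, 1 :: int}"
    "\<forall>e\<in>arcs D. g e = f e + int_scale (c e) x" using assms by (auto simp: move_def)
  show ?thesis unfolding move_def
  proof (intro conjI exI[of _ c] exI[of _ "- x"] ballI)
    fix e assume "e \<in> arcs D"
    then show "f e = g e + int_scale (c e) (- x)" using c by force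
  qed (use assms c in \<open>auto simp: move_def\<close>)
qed

text \<open>
  This is how flow-connectedness is carried back along a reduction: \<open>P\<close> turns flows of the reduced
  graph into flows of the original one, and only reaches all of them up to a move.
\<close>

lemma linked_flows_transfer:
  fixes P :: "('e2 \<Rightarrow> 'a::ab_group_add) \<Rightarrow> 'e \<Rightarrow> 'a"
  assumes "linked_flows TYPE('a) D'"
    and P: "\<And>k k'. move D' k k' \<Longrightarrow> move D (P k) (P k')"
    and lift: "\<And>f. nz_flow D f \<Longrightarrow> \<exists>k. nz_flow D' k \<and> move D f (P k)"
  shows "linked_flows TYPE('a) D"
  unfolding linked_flows_def
proof (intro allI impI)
  fix f g :: "'e \<Rightarrow> 'a" assume "nz_flow D f" "nz_flow D g"
  then obtain k l where k: "nz_flow D' k" "move D f (P k)" and l: "nz_flow D' l" "move D g (P l)"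
    using lift by meson
  have "(move D')\<^sup>*\<^sup>* k l" using assms(1) k l by (auto simp: linked_flows_def)
  then have "(move D)\<^sup>*\<^sup>* (P k) (P l)"
    by (induction rule: rtranclp_induct) (auto intro: P rtranclp.rtrancl_into_rtrancl)
  then show "(move D)\<^sup>*\<^sup>* f g"
    using k(2) move_sym[OF l(2)]
    by (meson converse_rtranclp_into_rtranclp rtranclp.rtrancl_into_rtrancl)
qed


section \<open>Moves and changes along cycles\<close>

lemma orientation_fin_digraph:
  assumes "multigraph G" "orientation G D"
  shows "fin_digraph D"
proof
  have m: "finite (vertices G)" "finite (edges G)" "\<And>e. e \<in> edges G \<Longrightarrow> ends G e \<subseteq> vertices G"
    using assms by (auto simp: multigraph_def)
  have o: "verts D = vertices G" "arcs D = edges G"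
    "\<And>e. e \<in> edges G \<Longrightarrow> {tail D e, head D e} = ends G e"
    using assms by (auto simp: orientation_def)
  show "finite (verts D)" "finite (arcs D)" using m o by auto
  show "tail D e \<in> verts D" "head D e \<in> verts D" if "e \<in> arcs D" for e
    using m o that by blast+
qed

lemma flows_iff:
  assumes "finite (arcs D)"
  shows "f \<in> flows D \<longleftrightarrow> f \<in> extensional (arcs D) \<and> nz_flow D f"
proof -
  have "(\<Sum>e\<in>out_arcs D v. f e) - (\<Sum>e\<in>in_arcs D v. f e) = boundary D f v" for v
    unfolding boundary_def sum_subtractf using assms
    by (simp add: sum.inter_filter[symmetric] out_arcs_def in_arcs_def)
  then show ?thesis
    unfolding flows_def nz_flow_def circulation_def mem_Collect_eq PiE_iff by auto
qed

lemma restrict_mem_flows: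
  assumes "finite (arcs D)" "nz_flow D f"
  shows "restrict f (arcs D) \<in> flows D"
  using assms nz_flow_cong[of D "restrict f (arcs D)" f] by (simp add: flows_iff)

text \<open>
  A minimal nonempty closed set \<open>Q\<close> is a periodic orbit: its image is closed, hence equal to \<open>Q\<close>.
  Minimality in the last conclusion stands for the orbit being a single one and later gives the
  connectedness of a cycle without any choice of paths.
\<close>

lemma finite_self_map_orbit:
  fixes \<phi> :: "'v \<Rightarrow> 'v"
  assumes "finite W" "W \<noteq> {}" "\<phi> ` W \<subseteq> W"
  obtains Q where "Q \<subseteq> W" "Q \<noteq> {}" "bij_betw \<phi> Q Q"
    "\<And>R. R \<subseteq> Q \<Longrightarrow> R \<noteq> {} \<Longrightarrow> \<phi> ` R \<subseteq> R \<Longrightarrow> R = Q"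
proof -
  define closed where "closed Q \<longleftrightarrow> Q \<subseteq> W \<and> Q \<noteq> {} \<and> \<phi> ` Q \<subseteq> Q" for Q
  have "closed W" using assms by (auto simp: closed_def)
  then obtain Q where Q: "closed Q" and min: "\<And>R. closed R \<Longrightarrow> card Q \<le> card R"
    using ex_has_least_nat[of closed W card] by blast
  have fin: "finite Q" using Q assms(1) finite_subset by (auto simp: closed_def)
  have eq: "R = Q" if "R \<subseteq> Q" "R \<noteq> {}" "\<phi> ` R \<subseteq> R" for R
  proof -
    have "closed R" using that Q by (auto simp: closed_def)
    then show ?thesis using min that(1) fin by (meson card_subset_eq card_mono le_antisym)
  qed
  have "\<phi> ` Q = Q" using Q by (intro eq) (auto simp: closed_def)
  then have "bij_betw \<phi> Q Q" using fin by (simp add: bij_betw_def finite_surj_inj)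
  then show ?thesis using that Q eq by (auto simp: closed_def)
qed

text \<open>
  Direct the supporting edges such that the circulation is one on each of them. Every vertex
  entered by such an edge is also left by one; choosing an outgoing edge at each vertex gives a
  self-map of a finite set, and a periodic orbit of this map is a directed cycle.
\<close>

lemma circulation_contains_cycle:
  fixes c :: "'e \<Rightarrow> int"
  assumes G: "multigraph G" and D: "orientation G D"
    and circ: "circulation D c" and c: "\<forall>e\<in>arcs D. c e \<in> {- 1, 0, 1}"
    and e0: "e0 \<in> arcs D" "c e0 \<noteq> 0"
  obtains C where "is_cycle C" "subgraph_of C G" "edges C \<noteq> {}" "\<forall>e\<in>edges C. c e \<noteq> 0"
    "circulation D (\<lambda>e. if e \<in> edges C then c e else 0)"
proof -
  interpret fin_digraph D by (rule orientation_fin_digraph[OF G D])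
  have o: "verts D = vertices G" "arcs D = edges G"
    "\<And>e. e \<in> arcs D \<Longrightarrow> {tail D e, head D e} = ends G e"
    using D by (auto simp: orientation_def)
  define S where "S = {e \<in> arcs D. c e \<noteq> 0}"
  \<comment> \<open>ends with respect to the direction in which the circulation is one\<close>
  define t where "t e = (if c e = 1 then tail D e else head D e)" for e
  define h where "h e = (if c e = 1 then head D e else tail D e)" for e
  have finS: "finite S" by (simp add: S_def)
  have bd: "boundary D (\<lambda>e. if e \<in> F then c e else 0) v =
      (\<Sum>e\<in>F. (if t e = v then 1 else 0) - (if h e = v then 1 else 0))" if "F \<subseteq> S" for F v
  proof -
    have "boundary D (\<lambda>e. if e \<in> F then c e else 0) v = (\<Sum>e\<in>arcs D. if e \<in> F then
        (if t e = v then 1 else 0) - (if h e = v then 1 else 0) else 0)"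
      unfolding boundary_def using c that
      by (intro sum.cong) (fastforce simp: t_def h_def S_def)+
    also have "\<dots> = (\<Sum>e\<in>F. (if t e = v then 1 else 0) - (if h e = v then 1 else 0))"
      using that finite_arcs by (intro sum.mono_neutral_cong_right) (auto simp: S_def)
    finally show ?thesis .
  qed
  have in_out: "h e \<in> t ` S" if e: "e \<in> S" for e
  proof (rule ccontr)
    assume n: "h e \<notin> t ` S"
    have "boundary D c (h e) = boundary D (\<lambda>e. if e \<in> S then c e else 0) (h e)"
      by (rule boundary_cong) (auto simp: S_def)
    also have "\<dots> = (\<Sum>e'\<in>S. (if t e' = h e then 1 else 0) - (if h e' = h e then 1 else 0))"
      by (rule bd) simp
    also have "\<dots> = (\<Sum>e'\<in>S. - (if h e' = h e then 1 else 0))"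
      using n by (intro sum.cong refl) (metis diff_0 imageI)
    also have "\<dots> = - (\<Sum>e'\<in>S. if h e' = h e then 1 else 0)"
      by (rule sum_negf)
    also have "\<dots> < 0"
      using e finS sum_pos2[of S e "\<lambda>e'. if h e' = h e then 1 else (0::int)"] by simp
    finally have "boundary D c (h e) < 0" .
    moreover have "h e \<in> verts D" using e by (auto simp: h_def S_def)
    ultimately show False using circ by (auto simp: circulation_def)
  qed
  define s where "s w = (SOME e. e \<in> S \<and> t e = w)" for w
  have s: "s w \<in> S" "t (s w) = w" if "w \<in> t ` S" for w
    using someI_ex[of "\<lambda>e. e \<in> S \<and> t e = w"] that by (auto simp: s_def)
  define \<phi> where "\<phi> w = h (s w)" for w
  have "finite (t ` S)" "t ` S \<noteq> {}" "\<phi> ` (t ` S) \<subseteq> t ` S"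
    using finS e0 s in_out by (auto simp: S_def \<phi>_def)
  then obtain Q where Q: "Q \<subseteq> t ` S" "Q \<noteq> {}" and bij: "bij_betw \<phi> Q Q"
    and min: "\<And>R. R \<subseteq> Q \<Longrightarrow> R \<noteq> {} \<Longrightarrow> \<phi> ` R \<subseteq> R \<Longrightarrow> R = Q"
    using finite_self_map_orbit[of "t ` S" \<phi>] by blast
  have sQ: "s w \<in> S" "t (s w) = w" "h (s w) = \<phi> w" if "w \<in> Q" for w
    using s Q that by (auto simp: \<phi>_def)
  have inj: "inj_on s Q" by (metis inj_onI sQ(2))
  have sS: "s ` Q \<subseteq> S" using sQ by auto
  have finQ: "finite Q" using Q(1) finS finite_subset by blast
  have phiQ: "\<phi> w \<in> Q" if "w \<in> Q" for w using bij that by (auto simp: bij_betw_def)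
  define C where "C = \<lparr>vertices = Q, edges = s ` Q, ends = ends G\<rparr>"
  have C: "vertices C = Q" "edges C = s ` Q" "ends C = ends G" by (simp_all add: C_def)
  have ends: "ends G (s w) = {w, \<phi> w}" if "w \<in> Q" for w
    using sQ[OF that] o(3)[of "s w"] unfolding t_def h_def S_def by (auto split: if_splits)
  have QV: "Q \<subseteq> vertices G" using Q o by (force simp: t_def S_def)
  have mC: "multigraph C"
    unfolding multigraph_def C using finQ ends phiQ by (auto simp: card_insert_if)
  have one: "card {w \<in> Q. \<phi> w = v} = 1" "card {w \<in> Q. w = v} = 1" if "v \<in> Q" for v
  proof -
    have "v \<in> \<phi> ` Q" unfolding bij_betw_imp_surj_on[OF bij] by (rule that)
    then obtain w where w: "w \<in> Q" "\<phi> w = v" by blast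
    then have "w' = w" if "w' \<in> Q" "\<phi> w' = v" for w'
      using inj_onD[OF bij_betw_imp_inj_on[OF bij], of w' w] that by simp
    then have "{w \<in> Q. \<phi> w = v} = {w}" using w by blast
    then show "card {w \<in> Q. \<phi> w = v} = 1" by simp
    have "{w \<in> Q. w = v} = {v}" using that by auto
    then show "card {w \<in> Q. w = v} = 1" by simp
  qed
  have deg: "degree C v = 2" if v: "v \<in> Q" for v
  proof -
    let ?A = "{w \<in> Q. \<phi> w = v}" and ?B = "{w \<in> Q. w = v}"
    have "v \<in> ends G (s w) \<longleftrightarrow> \<phi> w = v \<or> w = v"
      "ends G (s w) = {v} \<longleftrightarrow> \<phi> w = v \<and> w = v" if "w \<in> Q" for w
      unfolding ends[OF that] by blast+
    then have I: "{e \<in> edges C. v \<in> ends C e} = s ` (?A \<union> ?B)"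
      and L: "{e \<in> edges C. ends C e = {v}} = s ` (?A \<inter> ?B)"
      unfolding C by blast+
    have fin: "finite ?A" "finite ?B" using finQ by simp_all
    have "?A \<union> ?B \<subseteq> Q" "?A \<inter> ?B \<subseteq> Q" by blast+
    then have "inj_on s (?A \<union> ?B)" "inj_on s (?A \<inter> ?B)"
      using inj_on_subset[OF inj] by blast+
    then have "degree C v = card (?A \<union> ?B) + card (?A \<inter> ?B)"
      unfolding degree_def I L by (simp only: card_image)
    also have "\<dots> = card ?A + card ?B"
      by (rule card_Un_Int[OF fin, symmetric])
    also have "\<dots> = 2" by (simp only: one[OF v])
    finally show ?thesis .
  qed
  have adj: "(w, \<phi> w) \<in> adj_rel C" if "w \<in> Q" for w
    using that ends by (auto simp: adj_rel_def C)
  have "{u \<in> Q. (w, u) \<in> (adj_rel C)\<^sup>*} = Q" if "w \<in> Q" for w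
    using that adj phiQ by (intro min) (auto intro: rtrancl_into_rtrancl)
  then have conn: "connected_mgraph C" using Q by (auto simp: connected_mgraph_def C)
  have cyc: "is_cycle C" using mC conn deg by (auto simp: is_cycle_def regular_mgraph_def C)
  have sub: "subgraph_of C G"
    using mC QV sS o by (auto simp: subgraph_of_def C S_def)
  have "boundary D (\<lambda>e. if e \<in> s ` Q then c e else 0) v = 0" for v
  proof -
    have "boundary D (\<lambda>e. if e \<in> s ` Q then c e else 0) v =
        (\<Sum>w\<in>Q. (if w = v then 1 else 0) - (if \<phi> w = v then 1 else 0))"
      unfolding bd[OF sS] sum.reindex[OF inj] using sQ by (intro sum.cong) auto
    also have "\<dots> = (\<Sum>w\<in>Q. if w = v then 1 else 0) - (\<Sum>w\<in>Q. if \<phi> w = v then 1 else 0)"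
      by (rule sum_subtractf)
    also have "(\<Sum>w\<in>Q. if \<phi> w = v then 1 else 0) = (\<Sum>w\<in>Q. if w = v then 1 else (0::int))"
      by (rule sum.reindex_bij_betw[OF bij])
    finally show ?thesis by simp
  qed
  then have "circulation D (\<lambda>e. if e \<in> edges C then c e else 0)"
    by (simp add: circulation_def C)
  moreover have "\<forall>e\<in>edges C. c e \<noteq> 0" using sS by (auto simp: C S_def)
  ultimately show ?thesis using that cyc sub Q(2) by (simp add: C)
qed

text \<open>
  Split a cycle off the support of \<open>c\<close> and replace \<open>f\<close> by \<open>g\<close> on it. The intermediate
  function takes only values of \<open>f\<close> and \<open>g\<close>, so it is nowhere zero.
\<close>

lemma move_imp_equivalent_flows:
  fixes f g :: "'e \<Rightarrow> 'a::ab_group_add" and c :: "'e \<Rightarrow> int"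
  assumes G: "multigraph G" and D: "orientation G D"
    and f: "f \<in> flows D" and g: "g \<in> flows D"
    and c: "circulation D c" "\<forall>e\<in>arcs D. c e \<in> {- 1, 0, 1}"
    and diff: "\<forall>e\<in>arcs D. g e = f e + int_scale (c e) x"
  shows "equivalent_flows G D f g"
proof -
  interpret fin_digraph D by (rule orientation_fin_digraph[OF G D])
  have arcs: "arcs D = edges G" using D by (simp add: orientation_def)
  show ?thesis using f c diff
  proof (induction "card {e \<in> arcs D. c e \<noteq> 0}" arbitrary: f c rule: less_induct)
    case less
    show ?case
    proof (cases "\<forall>e\<in>arcs D. c e = 0")
      case True
      then have "f = g" using less.prems g finite_arcs
        by (intro extensionalityI[of _ "arcs D"]) (auto simp: flows_iff)
      then show ?thesis by (simp add: equivalent_flows_def)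
    next
      case False
      then obtain e0 where e0: "e0 \<in> arcs D" "c e0 \<noteq> 0" by blast
      obtain C where C: "is_cycle C" "subgraph_of C G" "edges C \<noteq> {}" "\<forall>e\<in>edges C. c e \<noteq> 0"
        "circulation D (\<lambda>e. if e \<in> edges C then c e else 0)"
        by (rule circulation_contains_cycle[OF G D less.prems(2,3) e0])
      have CD: "edges C \<subseteq> arcs D" using C(2) arcs by (auto simp: subgraph_of_def)
      \<comment> \<open>the part of the change that happens on \<open>C\<close>, and what is left of it\<close>
      define c1 where "c1 e = (if e \<in> edges C then c e else 0)" for e
      define c2 where "c2 e = c e - c1 e" for e
      define f1 where "f1 e = (if e \<in> edges C then g e else f e)" for e
      have f1: "f1 e = f e + int_scale (c1 e) x" "g e = f1 e + int_scale (c2 e) x"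
        if "e \<in> arcs D" for e
        using less.prems(4) that by (auto simp: f1_def c1_def c2_def)
      have "circulation D (\<lambda>e. f e + int_scale (c1 e) x)"
        unfolding c1_def
        by (rule circulation_add[OF _ circulation_int_scale[OF C(5)]])
          (use less.prems(1) finite_arcs in \<open>simp add: flows_iff nz_flow_def\<close>)
      then have "circulation D f1" using f1(1) circulation_cong[of D f1] by simp
      then have f1_flow: "f1 \<in> flows D" using less.prems(1) g finite_arcs CD
        by (auto simp: flows_iff nz_flow_def f1_def extensional_def)
      have adj: "adjacent_flows G f f1"
        unfolding adjacent_flows_def
        by (intro exI[of _ C] conjI C) (simp add: f1_def)
      have "circulation D c2"
        using circulation_diff[OF less.prems(2) C(5)] by (simp add: c2_def[abs_def] c1_def)
      moreover have "\<forall>e\<in>arcs D. c2 e \<in> {- 1, 0, 1}"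
        using less.prems(3) by (auto simp: c2_def c1_def)
      moreover have "card {e \<in> arcs D. c2 e \<noteq> 0} < card {e \<in> arcs D. c e \<noteq> 0}"
      proof (rule psubset_card_mono)
        obtain e where e: "e \<in> edges C" using C(3) by blast
        then have "e \<in> {e \<in> arcs D. c e \<noteq> 0}" "e \<notin> {e \<in> arcs D. c2 e \<noteq> 0}"
          using C(4) CD by (auto simp: c2_def c1_def)
        moreover have "{e \<in> arcs D. c2 e \<noteq> 0} \<subseteq> {e \<in> arcs D. c e \<noteq> 0}"
          by (auto simp: c2_def c1_def)
        ultimately show "{e \<in> arcs D. c2 e \<noteq> 0} \<subset> {e \<in> arcs D. c e \<noteq> 0}"
          by blast
      qed simp
      ultimately have "equivalent_flows G D f1 g"
        using less.hyps f1_flow f1(2) by blast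
      moreover have "f \<in> flows D \<and> f1 \<in> flows D \<and> adjacent_flows G f f1"
        using less.prems(1) f1_flow adj by blast
      ultimately show ?thesis
        unfolding equivalent_flows_def by (metis (lifting) converse_rtranclp_into_rtranclp)
    qed
  qed
qed

lemma cycle_degree_cases:
  assumes "is_cycle C" "v \<in> vertices C" "e \<in> edges C" "v \<in> ends C e"
    "e' \<in> edges C" "v \<in> ends C e'" "e \<noteq> e'"
  shows "{d \<in> edges C. v \<in> ends C d} = {e, e'}" "ends C e \<noteq> {v}" "ends C e' \<noteq> {v}"
proof -
  let ?I = "{d \<in> edges C. v \<in> ends C d}" and ?L = "{d \<in> edges C. ends C d = {v}}"
  have deg: "card ?I + card ?L = 2" and fin: "finite (edges C)"
    using assms(1,2) by (auto simp: is_cycle_def regular_mgraph_def degree_def multigraph_def)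
  have sub: "{e, e'} \<subseteq> ?I" using assms by auto
  then have "card {e, e'} \<le> card ?I" using fin by (intro card_mono) auto
  then have "card ?I = 2" "card ?L = 0" using deg assms(7) by auto
  then show "?I = {e, e'}" "ends C e \<noteq> {v}" "ends C e' \<noteq> {v}"
    using sub fin assms card_subset_eq[of ?I "{e, e'}"] by auto
qed

text \<open>
  Two edges of the cycle meeting at a vertex are the only ones there that carry flow, so their values
  agree up to sign; connectedness spreads this over the cycle.
\<close>

lemma circulation_on_cycle_constant:
  fixes k :: "'e \<Rightarrow> 'b::ab_group_add"
  assumes G: "multigraph G" and D: "orientation G D" and C: "is_cycle C" "subgraph_of C G"
    and k: "circulation D k" "\<forall>e\<in>arcs D - edges C. k e = 0"
    and e: "e \<in> edges C" and e0: "e0 \<in> edges C"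
  shows "k e = k e0 \<or> k e = - k e0"
proof -
  interpret fin_digraph D by (rule orientation_fin_digraph[OF G D])
  have o: "verts D = vertices G" "arcs D = edges G"
    "\<And>e. e \<in> arcs D \<Longrightarrow> {tail D e, head D e} = ends G e"
    using D by (auto simp: orientation_def)
  have sub: "vertices C \<subseteq> verts D" "edges C \<subseteq> arcs D"
    using C(2) o by (auto simp: subgraph_of_def)
  have ends_C: "ends C e = {tail D e, head D e}" if "e \<in> edges C" for e
    using C(2) o(3)[of e] sub(2) that by (auto simp: subgraph_of_def)
  have mC: "multigraph C" "connected_mgraph C" using C(1) by (auto simp: is_cycle_def)
  have local_eq: "k d' = k d \<or> k d' = - k d"
    if v: "v \<in> vertices C" and d: "d \<in> edges C" "v \<in> ends C d" "d' \<in> edges C" "v \<in> ends C d'"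
    for v d d'
  proof (cases "d = d'")
    case False
    note cd = cycle_degree_cases[OF C(1) v d False]
    have "0 = boundary D k v" using k(1) v sub(1) unfolding circulation_def by (metis subsetD)
    also have "\<dots> = (\<Sum>e\<in>{d, d'}. (if tail D e = v then k e else 0) - (if head D e = v then k e else 0))"
      unfolding boundary_def
    proof (rule sum.mono_neutral_right)
      have "v \<notin> ends C e" if "e \<in> edges C" "e \<notin> {d, d'}" for e
        using cd(1) that by blast
      then show "\<forall>e\<in>arcs D - {d, d'}. (if tail D e = v then k e else 0) -
          (if head D e = v then k e else 0) = 0"
        using k(2) ends_C by auto
    qed (use d sub in auto)
    also have "\<dots> = ((if tail D d = v then k d else 0) - (if head D d = v then k d else 0)) +
        ((if tail D d' = v then k d' else 0) - (if head D d' = v then k d' else 0))"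
      using False by simp
    finally have bal: "(if tail D d = v then k d else 0) - (if head D d = v then k d else 0) +
        ((if tail D d' = v then k d' else 0) - (if head D d' = v then k d' else 0)) = 0" by simp
    have "(tail D d = v) \<noteq> (head D d = v)" "(tail D d' = v) \<noteq> (head D d' = v)"
      using cd(2,3) d(2,4) unfolding ends_C[OF d(1)] ends_C[OF d(3)] by auto
    then show ?thesis using bal
      by (cases "tail D d = v"; cases "tail D d' = v")
        (auto simp: eq_neg_iff_add_eq_0 neg_eq_iff_add_eq_0 add.commute)
  qed simp
  obtain u where u: "u \<in> ends C e0" "u \<in> vertices C"
    using ends_C[OF e0] mC(1) e0 by (auto simp: multigraph_def)
  have step: "k d = k e0 \<or> k d = - k e0"
    if "(u, v) \<in> (adj_rel C)\<^sup>*" "d \<in> edges C" "v \<in> ends C d" for v d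
    using that
  proof (induction arbitrary: d rule: rtrancl_induct)
    case base
    then show ?case using local_eq[of u e0 d] u e0 by blast
  next
    case (step v w)
    then obtain d1 where d1: "d1 \<in> edges C" "ends C d1 = {v, w}" by (auto simp: adj_rel_def)
    have "w \<in> vertices C" using mC(1) d1 by (auto simp: multigraph_def)
    then have "k d = k d1 \<or> k d = - k d1" using local_eq[of w d1 d] d1 step.prems by blast
    moreover have "k d1 = k e0 \<or> k d1 = - k e0" using step.IH[of d1] d1 by blast
    ultimately show ?case by auto
  qed
  obtain v where v: "v \<in> ends C e" "v \<in> vertices C"
    using ends_C[OF e] mC(1) e by (auto simp: multigraph_def)
  have "(u, v) \<in> (adj_rel C)\<^sup>*" using mC(2) u v by (auto simp: connected_mgraph_def)
  then show ?thesis using step e v by blast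
qed

text \<open>
  If \<open>e0\<close> were a bridge of the subgraph formed by \<open>F\<close>, then it would be the only edge carrying flow
  across some cut, which is impossible. So the ends of \<open>e0\<close> are joined by a walk avoiding \<open>e0\<close>, and this walk closes up with
  \<open>e0\<close> to an integer circulation. A walk may repeat edges, so the coefficients are not bounded here.
\<close>

lemma circulation_through_arc:
  fixes k :: "'e \<Rightarrow> 'b::ab_group_add"
  assumes "fin_digraph D" and k: "circulation D k" "\<forall>e\<in>arcs D - F. k e = 0"
    and e0: "e0 \<in> arcs D" "k e0 \<noteq> 0"
  obtains c :: "'e \<Rightarrow> int" where "circulation D c" "c e0 = 1" "\<forall>e\<in>arcs D - F. c e = 0"
proof -
  interpret fin_digraph D by fact
  define R where "R = {(x, y). \<exists>e\<in>arcs D \<inter> F - {e0}. {tail D e, head D e} = {x, y}}"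
  let ?u = "tail D e0" and ?v = "head D e0"
  define X where "X = {w \<in> verts D. (?u, w) \<in> R\<^sup>*}"
  have uv: "?u \<in> verts D" "?v \<in> verts D" using e0 by auto
  have "?v \<in> X"
  proof (rule ccontr)
    assume n: "?v \<notin> X"
    have "?u \<in> X" using uv by (simp add: X_def)
    have cut: "k e = 0" if "e \<in> cut D X" "e \<noteq> e0" for e
    proof (rule ccontr)
      assume "k e \<noteq> 0"
      then have "e \<in> arcs D \<inter> F - {e0}" using that k(2) by (auto simp: cut_def)
      then have "(tail D e, head D e) \<in> R" "(head D e, tail D e) \<in> R"
        "tail D e \<in> verts D" "head D e \<in> verts D"
        by (auto simp: R_def)
      then have "tail D e \<in> X \<longleftrightarrow> head D e \<in> X"
        by (auto simp: X_def intro: rtrancl_into_rtrancl)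
      then show False using that by (auto simp: cut_def)
    qed
    have e0X: "e0 \<in> cut D X" using \<open>?u \<in> X\<close> n e0 by (auto simp: cut_def)
    have "(\<Sum>e\<in>cut D X. if tail D e \<in> X then k e else - k e) =
        (\<Sum>e\<in>{e0}. if tail D e \<in> X then k e else - k e)"
      using cut e0X by (intro sum.mono_neutral_right) (auto simp: cut_def)
    moreover have "(\<Sum>e\<in>cut D X. if tail D e \<in> X then k e else - k e) = 0"
      by (rule circulation_cut) (use assms in \<open>auto simp: X_def\<close>)
    ultimately show False using \<open>?u \<in> X\<close> e0 by simp
  qed
  then have "(?u, ?v) \<in> R\<^sup>*" by (simp add: X_def)
  then have "\<exists>p :: 'e \<Rightarrow> int. (\<forall>e. p e \<noteq> 0 \<longrightarrow> e \<in> arcs D \<inter> F - {e0}) \<and>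
      (\<forall>z. boundary D p z = (if z = ?u then 1 else 0) - (if z = ?v then 1 else 0))"
  proof (induction rule: rtrancl_induct)
    case base
    show ?case by (rule exI[of _ "\<lambda>_. 0"]) (simp add: boundary_def)
  next
    case (step x y)
    obtain p :: "'e \<Rightarrow> int" where p: "\<forall>e. p e \<noteq> 0 \<longrightarrow> e \<in> arcs D \<inter> F - {e0}"
      "\<forall>z. boundary D p z = (if z = ?u then 1 else 0) - (if z = x then 1 else 0)"
      using step.IH by blast
    obtain e where e: "e \<in> arcs D \<inter> F - {e0}" "{tail D e, head D e} = {x, y}"
      using step.hyps(2) by (auto simp: R_def)
    define a where "a = (if tail D e = x then 1 else - 1 :: int)"
    let ?q = "\<lambda>e'. p e' + (if e' = e then a else 0)"
    have "boundary D ?q z = (if z = ?u then 1 else 0) - (if z = y then 1 else 0)" for z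
      unfolding boundary_add using p(2) boundary_single_arc[of D e a z] e
      by (auto simp: a_def doubleton_eq_iff)
    moreover have "\<forall>e'. ?q e' \<noteq> 0 \<longrightarrow> e' \<in> arcs D \<inter> F - {e0}" using p(1) e(1) by auto
    ultimately show ?case by (intro exI[of _ ?q]) simp
  qed
  then obtain p :: "'e \<Rightarrow> int" where p: "\<forall>e. p e \<noteq> 0 \<longrightarrow> e \<in> arcs D \<inter> F - {e0}"
    "\<forall>z. boundary D p z = (if z = ?u then 1 else 0) - (if z = ?v then 1 else 0)" by blast
  let ?c = "\<lambda>e. (if e = e0 then 1 else 0) - p e"
  have "circulation D ?c" unfolding circulation_def boundary_diff
    using p(2) boundary_single_arc[of D e0 "1::int"] e0 by auto
  moreover have "?c e0 = 1" "\<forall>e\<in>arcs D - F. ?c e = 0" using p(1) k(2) e0 by auto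
  ultimately show ?thesis by (rule that)
qed

text \<open>
  The difference \<open>h\<close> of the two flows is supported on a cycle \<open>C\<close>. The cycle carries an integer
  circulation \<open>c\<close> with value one on an edge \<open>e0\<close> where \<open>h\<close> is nonzero, and by
  \<open>circulation_on_cycle_constant\<close> its values on \<open>C\<close> are signs. Then
  \<open>h - c \<cdot> h e0\<close> is a circulation on \<open>C\<close> vanishing on \<open>e0\<close>, hence zero.
\<close>

lemma adjacent_flows_imp_move:
  fixes f g :: "'e \<Rightarrow> 'a::ab_group_add"
  assumes G: "multigraph G" and D: "orientation G D"
    and f: "nz_flow D f" and g: "nz_flow D g" and adj: "adjacent_flows G f g"
  shows "move D f g"
proof (cases "\<forall>e\<in>arcs D. g e = f e")
  case True
  then show ?thesis using move_eq_on_arcs[OF f] by blast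
next
  case False
  interpret fin_digraph D by (rule orientation_fin_digraph[OF G D])
  have arcs: "arcs D = edges G" using D by (simp add: orientation_def)
  define h where "h e = g e - f e" for e
  obtain C where C: "is_cycle C" "subgraph_of C G" and eq: "\<forall>e\<in>arcs D - edges C. h e = 0"
    using adj by (auto simp: adjacent_flows_def h_def arcs)
  obtain e0 where e0: "e0 \<in> arcs D" "h e0 \<noteq> 0" using False by (auto simp: h_def)
  then have e0C: "e0 \<in> edges C" using eq by blast
  have h: "circulation D h"
    using circulation_diff f g by (auto simp: h_def[abs_def] nz_flow_def)
  obtain c :: "'e \<Rightarrow> int" where c: "circulation D c" "c e0 = 1" "\<forall>e\<in>arcs D - edges C. c e = 0"
    using circulation_through_arc[OF fin_digraph_axioms h eq e0] by blast
  have range: "c e \<in> {- 1, 0, 1}" if "e \<in> arcs D" for e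
    using circulation_on_cycle_constant[OF G D C c(1,3) _ e0C, of e] c(2,3) that by auto
  define k where "k e = h e - int_scale (c e) (h e0)" for e
  have "circulation D k" unfolding k_def[abs_def]
    by (rule circulation_diff[OF h circulation_int_scale[OF c(1)]])
  moreover have "\<forall>e\<in>arcs D - edges C. k e = 0" using eq c(3) by (simp add: k_def)
  moreover have "k e0 = 0" by (simp add: k_def c)
  ultimately have "k e = 0" if "e \<in> arcs D" for e
    using circulation_on_cycle_constant[OF G D C, of k e e0] e0C that by auto
  then have "g e = f e + int_scale (c e) (h e0)" if "e \<in> arcs D" for e
    using that by (auto simp: k_def h_def algebra_simps)
  then show ?thesis unfolding move_def using f g c(1) range by blast
qed

lemma flow_connected_wrt_iff_linked_flows:
  assumes G: "multigraph G" and D: "orientation G D"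
  shows "flow_connected_wrt TYPE('a::ab_group_add) G D \<longleftrightarrow> linked_flows TYPE('a) D"
proof -
  interpret fin_digraph D by (rule orientation_fin_digraph[OF G D])
  have move_eq: "equivalent_flows G D (restrict f (arcs D)) (restrict g (arcs D))"
    if m: "move D f g" for f g :: "_ \<Rightarrow> 'a"
  proof -
    obtain c :: "_ \<Rightarrow> int" and x where c: "circulation D c" "\<forall>e\<in>arcs D. c e \<in> {- 1, 0, 1}"
      "\<forall>e\<in>arcs D. g e = f e + int_scale (c e) x" using m by (auto simp: move_def)
    show ?thesis
      by (rule move_imp_equivalent_flows[OF G D _ _ c(1,2)])
        (use m c(3) in \<open>auto simp: move_def intro!: restrict_mem_flows\<close>)
  qed
  show ?thesis
  proof
    assume L: "linked_flows TYPE('a) D"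
    show "flow_connected_wrt TYPE('a) G D"
      unfolding flow_connected_wrt_def
    proof (intro ballI)
      fix f g :: "_ \<Rightarrow> 'a" assume fg: "f \<in> flows D" "g \<in> flows D"
      then have "(move D)\<^sup>*\<^sup>* f g" using L by (auto simp: linked_flows_def flows_iff)
      then have "equivalent_flows G D (restrict f (arcs D)) (restrict g (arcs D))"
      proof (induction rule: rtranclp_induct)
        case base show ?case by (simp add: equivalent_flows_def)
      next
        case (step y z)
        then show ?case using move_eq[of y z] unfolding equivalent_flows_def
          by (meson rtranclp_trans)
      qed
      then show "equivalent_flows G D f g" using fg by (simp add: flows_iff extensional_restrict)
    qed
  next
    assume W: "flow_connected_wrt TYPE('a) G D"
    have lift: "(move D)\<^sup>*\<^sup>* f g" if "equivalent_flows G D f g" for f g :: "_ \<Rightarrow> 'a"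
      using that unfolding equivalent_flows_def
      by (rule rtranclp_mono[THEN predicate2D, rotated])
        (use adjacent_flows_imp_move[OF G D] in \<open>auto simp: flows_iff\<close>)
    show "linked_flows TYPE('a) D"
      unfolding linked_flows_def
    proof (intro allI impI)
      fix f g :: "_ \<Rightarrow> 'a" assume fg: "nz_flow D f" "nz_flow D g"
      let ?r = "\<lambda>f. restrict f (arcs D)"
      have "(move D)\<^sup>*\<^sup>* (?r f) (?r g)"
        using W fg by (intro lift) (auto simp: flow_connected_wrt_def restrict_mem_flows)
      moreover have "move D f (?r f)" "move D g (?r g)"
        using fg by (auto intro: move_eq_on_arcs)
      ultimately show "(move D)\<^sup>*\<^sup>* f g" using move_sym[of D g "?r g"]
        by (meson converse_rtranclp_into_rtranclp rtranclp.rtrancl_into_rtrancl)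
    qed
  qed
qed

section \<open>Edge-connectivity through cuts\<close>

text \<open>
  Edge-connectivity in the form used below; as for \<^const>\<open>edge_connected\<close>, a single vertex
  satisfies it for every \<open>k\<close>.
\<close>

definition cut_connected :: "nat \<Rightarrow> ('v, 'e) pre_digraph \<Rightarrow> bool" where
  "cut_connected k D \<longleftrightarrow> verts D \<noteq> {} \<and>
     (\<forall>X. X \<subseteq> verts D \<longrightarrow> X \<noteq> {} \<longrightarrow> X \<noteq> verts D \<longrightarrow> k \<le> card (cut D X))"

definition loopless :: "('v, 'e) pre_digraph \<Rightarrow> bool" where
  "loopless D \<longleftrightarrow> (\<forall>e\<in>arcs D. tail D e \<noteq> head D e)"

lemma cut_connectedD:
  "cut_connected k D \<Longrightarrow> X \<subseteq> verts D \<Longrightarrow> X \<noteq> {} \<Longrightarrow> X \<noteq> verts D \<Longrightarrow> k \<le> card (cut D X)"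
  by (simp add: cut_connected_def)

lemma finite_cut: "finite (arcs D) \<Longrightarrow> finite (cut D X)"
  by (simp add: cut_def)

lemma connected_mgraph_iff_cuts:
  assumes H: "multigraph H"
  shows "connected_mgraph H \<longleftrightarrow> vertices H \<noteq> {} \<and>
    (\<forall>X. X \<subseteq> vertices H \<longrightarrow> X \<noteq> {} \<longrightarrow> X \<noteq> vertices H \<longrightarrow>
      (\<exists>e\<in>edges H. ends H e \<inter> X \<noteq> {} \<and> \<not> ends H e \<subseteq> X))"
    (is "_ \<longleftrightarrow> _ \<and> ?cuts")
proof (intro iffI conjI)
  assume c: "connected_mgraph H"
  then show "vertices H \<noteq> {}" by (simp add: connected_mgraph_def)
  show ?cuts
  proof (intro allI impI)
    fix X assume X: "X \<subseteq> vertices H" "X \<noteq> {}" "X \<noteq> vertices H"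
    then obtain u w where uw: "u \<in> X" "w \<in> vertices H" "w \<notin> X" by blast
    then have "(u, w) \<in> (adj_rel H)\<^sup>*" using c X(1) unfolding connected_mgraph_def by blast
    then show "\<exists>e\<in>edges H. ends H e \<inter> X \<noteq> {} \<and> \<not> ends H e \<subseteq> X"
      using uw(1,3)
    proof (induction rule: rtrancl_induct)
      case (step y z)
      show ?case
      proof (cases "y \<in> X")
        case True
        obtain e where "e \<in> edges H" "ends H e = {y, z}"
          using step.hyps(2) by (auto simp: adj_rel_def)
        then show ?thesis using True step.prems by (intro bexI[of _ e]) auto
      qed (use step in blast)
    qed simp
  qed
next
  assume r: "vertices H \<noteq> {} \<and> ?cuts"
  show "connected_mgraph H"
    unfolding connected_mgraph_def
  proof (intro conjI ballI)
    show "vertices H \<noteq> {}" using r by blast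
    fix u w assume u: "u \<in> vertices H" and w: "w \<in> vertices H"
    define X where "X = {w \<in> vertices H. (u, w) \<in> (adj_rel H)\<^sup>*}"
    have "X = vertices H"
    proof (rule ccontr)
      assume "X \<noteq> vertices H"
      moreover have "X \<subseteq> vertices H" "u \<in> X" using u by (auto simp: X_def)
      ultimately obtain e where e: "e \<in> edges H" "ends H e \<inter> X \<noteq> {}" "\<not> ends H e \<subseteq> X"
        using r by blast
      then obtain a b where ab: "a \<in> ends H e" "a \<in> X" "b \<in> ends H e" "b \<notin> X" by blast
      have "finite (ends H e)" "card (ends H e) \<le> 2" and sub: "ends H e \<subseteq> vertices H"
        using H e(1) finite_subset by (auto simp: multigraph_def)
      moreover have "card {a, b} = 2" using ab card_2_iff by blast
      ultimately have "{a, b} = ends H e" using ab by (intro card_seteq) auto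
      then have "(a, b) \<in> adj_rel H" using e(1) by (auto simp: adj_rel_def)
      then have "b \<in> X" using ab sub by (auto simp: X_def intro: rtrancl_into_rtrancl)
      then show False using ab by blast
    qed
    then show "(u, w) \<in> (adj_rel H)\<^sup>*" using w by (auto simp: X_def)
  qed
qed

lemma orientation_crossing_iff_cut:
  assumes "orientation G D" "e \<in> edges G"
  shows "ends G e \<inter> X \<noteq> {} \<and> \<not> ends G e \<subseteq> X \<longleftrightarrow> e \<in> cut D X"
proof -
  have "ends G e = {tail D e, head D e}" "e \<in> arcs D" using assms by (auto simp: orientation_def)
  then show ?thesis by (auto simp: cut_def)
qed

lemma edge_connected_iff_cut_connected:
  assumes G: "multigraph G" and D: "orientation G D" and k: "0 < k"
  shows "edge_connected k G \<longleftrightarrow> cut_connected k D"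
proof -
  interpret fin_digraph D by (rule orientation_fin_digraph[OF G D])
  have o: "verts D = vertices G" "arcs D = edges G" using D by (auto simp: orientation_def)
  have conn: "connected_mgraph (delete_edges G F) \<longleftrightarrow> verts D \<noteq> {} \<and>
      (\<forall>X. X \<subseteq> verts D \<longrightarrow> X \<noteq> {} \<longrightarrow> X \<noteq> verts D \<longrightarrow> \<not> cut D X \<subseteq> F)" for F
  proof -
    have m: "multigraph (delete_edges G F)"
      using G by (auto simp: multigraph_def delete_edges_def)
    have "(\<exists>e\<in>edges G - F. ends G e \<inter> X \<noteq> {} \<and> \<not> ends G e \<subseteq> X) \<longleftrightarrow> \<not> cut D X \<subseteq> F" for X
      using orientation_crossing_iff_cut[OF D, of _ X] o by (auto simp: cut_def)
    then show ?thesis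
      unfolding connected_mgraph_iff_cuts[OF m] by (simp add: delete_edges_def o)
  qed
  show ?thesis
  proof
    assume ec: "edge_connected k G"
    have "connected_mgraph (delete_edges G {})" using ec k by (simp add: edge_connected_def)
    moreover have "k \<le> card (cut D X)" if "X \<subseteq> verts D" "X \<noteq> {}" "X \<noteq> verts D" for X
    proof (rule ccontr)
      assume "\<not> k \<le> card (cut D X)"
      then have "connected_mgraph (delete_edges G (cut D X))"
        using ec o by (auto simp: edge_connected_def cut_def)
      then show False using conn[of "cut D X"] that by blast
    qed
    ultimately show "cut_connected k D" using conn[of "{}"] by (simp add: cut_connected_def)
  next
    assume cc: "cut_connected k D"
    show "edge_connected k G"
      unfolding edge_connected_def conn
    proof (intro allI impI conjI)
      show "verts D \<noteq> {}" using cc by (simp add: cut_connected_def)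
      fix F X assume F: "F \<subseteq> edges G \<and> card F < k" and X: "X \<subseteq> verts D" "X \<noteq> {}" "X \<noteq> verts D"
      have "finite F" using F o finite_arcs finite_subset by metis
      then show "\<not> cut D X \<subseteq> F"
        using cut_connectedD[OF cc X] F card_mono[of F "cut D X"] by linarith
    qed
  qed
qed

lemma cut_Compl: "fin_digraph D \<Longrightarrow> cut D (verts D - X) = cut D X"
proof -
  assume "fin_digraph D"
  then interpret fin_digraph D .
  show ?thesis by (auto simp: cut_def)
qed


section \<open>Contractions\<close>

text \<open>
  The edges of \<open>D'\<close> that are missing in \<open>D\<close> join vertices with the same image, so they become
  invisible once these vertices are identified. Both the contraction of an edge and the collapse of
  an expanded vertex are of this form.
\<close>

definition contraction :: "('w \<Rightarrow> 'v) \<Rightarrow> ('w, 'e) pre_digraph \<Rightarrow> ('v, 'e) pre_digraph \<Rightarrow> bool" where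
  "contraction \<pi> D' D \<longleftrightarrow> verts D = \<pi> ` verts D' \<and> arcs D \<subseteq> arcs D' \<and>
     (\<forall>e\<in>arcs D. tail D e = \<pi> (tail D' e) \<and> head D e = \<pi> (head D' e)) \<and>
     (\<forall>e\<in>arcs D' - arcs D. \<pi> (tail D' e) = \<pi> (head D' e))"

lemma boundary_contraction:
  assumes "fin_digraph D'" and c: "contraction \<pi> D' D"
  shows "boundary D f v = (\<Sum>w\<in>{w \<in> verts D'. \<pi> w = v}. boundary D' f w)"
proof -
  interpret fin_digraph D' by fact
  let ?W = "{w \<in> verts D'. \<pi> w = v}"
  have "(\<Sum>w\<in>?W. boundary D' f w) =
      (\<Sum>e\<in>arcs D'. \<Sum>w\<in>?W. (if tail D' e = w then f e else 0) - (if head D' e = w then f e else 0))"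
    unfolding boundary_def by (rule sum.swap)
  also have "\<dots> = (\<Sum>e\<in>arcs D'. (if \<pi> (tail D' e) = v then f e else 0) -
      (if \<pi> (head D' e) = v then f e else 0))"
    by (intro sum.cong refl) (simp add: sum_subtractf)
  also have "\<dots> = (\<Sum>e\<in>arcs D. (if \<pi> (tail D' e) = v then f e else 0) -
      (if \<pi> (head D' e) = v then f e else 0))"
    using c unfolding contraction_def by (intro sum.mono_neutral_right) auto
  also have "\<dots> = boundary D f v"
    using c unfolding boundary_def contraction_def by (intro sum.cong) auto
  finally show ?thesis by simp
qed

lemma circulation_contraction:
  assumes "fin_digraph D'" "contraction \<pi> D' D" "circulation D' f"
  shows "circulation D f"
  using assms(3) unfolding circulation_def boundary_contraction[OF assms(1,2)] by simp

lemma nz_flow_contraction: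
  assumes "fin_digraph D'" "contraction \<pi> D' D" "nz_flow D' f"
  shows "nz_flow D f"
  using assms circulation_contraction[OF assms(1,2), of f]
  by (auto simp: nz_flow_def contraction_def)

lemma move_contraction:
  assumes "fin_digraph D'" "contraction \<pi> D' D" "move D' f g"
  shows "move D f g"
proof -
  obtain c x where c: "circulation D' c" "\<forall>e\<in>arcs D'. c e \<in> {- 1, 0, 1 :: int}"
    "\<forall>e\<in>arcs D'. g e = f e + int_scale (c e) x" using assms(3) by (auto simp: move_def)
  have "arcs D \<subseteq> arcs D'" using assms(2) by (simp add: contraction_def)
  then show ?thesis unfolding move_def
    using assms(3) nz_flow_contraction[OF assms(1,2)] circulation_contraction[OF assms(1,2) c(1)] c(2,3)
    by (intro conjI exI[of _ c] exI[of _ x]) (auto simp: move_def)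
qed

lemma fin_digraph_contraction:
  assumes "fin_digraph D'" "contraction \<pi> D' D"
  shows "fin_digraph D"
proof -
  interpret fin_digraph D' by fact
  show ?thesis
  proof
    show "finite (verts D)" "finite (arcs D)"
      using assms(2) finite_subset[OF _ finite_arcs] by (auto simp: contraction_def)
    show "tail D e \<in> verts D" "head D e \<in> verts D" if "e \<in> arcs D" for e
      using assms(2) that by (auto simp: contraction_def)
  qed
qed

lemma cut_connected_contraction:
  assumes "fin_digraph D'" and c: "contraction \<pi> D' D" and k: "cut_connected k D'"
  shows "cut_connected k D"
  unfolding cut_connected_def
proof (intro conjI allI impI)
  interpret fin_digraph D' by fact
  show "verts D \<noteq> {}" using c k by (simp add: contraction_def cut_connected_def)
  fix X assume X: "X \<subseteq> verts D" "X \<noteq> {}" "X \<noteq> verts D"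
  let ?Y = "{w \<in> verts D'. \<pi> w \<in> X}"
  have "?Y \<noteq> {}" "?Y \<noteq> verts D'" using X c by (auto simp: contraction_def)
  then have "k \<le> card (cut D' ?Y)" by (intro cut_connectedD[OF k]) auto
  also have "cut D' ?Y = cut D X"
  proof (rule set_eqI)
    fix e
    have out: "\<pi> (tail D' e) = \<pi> (head D' e)" if "e \<in> arcs D'" "e \<notin> arcs D"
      using c that by (auto simp: contraction_def)
    have inner: "e \<in> arcs D'" "tail D e = \<pi> (tail D' e)" "head D e = \<pi> (head D' e)" if "e \<in> arcs D"
      using c that by (auto simp: contraction_def)
    show "e \<in> cut D' ?Y \<longleftrightarrow> e \<in> cut D X"
      by (cases "e \<in> arcs D"; cases "e \<in> arcs D'") (auto simp: cut_def inner out)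
  qed
  finally show "k \<le> card (cut D X)" .
qed


section \<open>Removing loops and two-edge cuts\<close>

lemma boundary_delete_loop:
  assumes "finite (arcs D)" "tail D l = head D l"
  shows "boundary (D\<lparr>arcs := arcs D - {l}\<rparr>) f v = boundary D f v"
  unfolding boundary_def using assms by (auto intro!: sum.mono_neutral_cong_left)

text \<open>
  Fix the value on the loop once and for all; every flow moves to one with this value, because the
  loop alone carries a circulation.
\<close>

lemma linked_flows_delete_loop:
  fixes D :: "('v, 'e) pre_digraph"
  assumes "fin_digraph D" and l: "l \<in> arcs D" "tail D l = head D l"
    and linked: "linked_flows TYPE('a::ab_group_add) (D\<lparr>arcs := arcs D - {l}\<rparr>)"
  shows "linked_flows TYPE('a) D"
proof (cases "\<exists>a::'a. a \<noteq> 0")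
  case False
  then have "\<not> nz_flow D f" for f :: "_ \<Rightarrow> 'a" using l by (auto simp: nz_flow_def)
  then show ?thesis by (simp add: linked_flows_def)
next
  case True
  then obtain a :: 'a where a: "a \<noteq> 0" by blast
  interpret fin_digraph D by fact
  let ?D' = "D\<lparr>arcs := arcs D - {l}\<rparr>"
  have circ: "circulation ?D' f \<longleftrightarrow> circulation D f" for f :: "_ \<Rightarrow> 'b::ab_group_add"
    using boundary_delete_loop[OF finite_arcs l(2), of f] by (simp add: circulation_def)
  have circ_upd: "circulation D (f(l := b)) \<longleftrightarrow> circulation ?D' f"
    for f :: "_ \<Rightarrow> 'b::ab_group_add" and b
    unfolding circ[symmetric] by (rule circulation_cong) auto
  have nz: "nz_flow D (f(l := a))" if "nz_flow ?D' f" for f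
    using that a circ_upd by (auto simp: nz_flow_def)
  show ?thesis
  proof (rule linked_flows_transfer[OF linked, where P = "\<lambda>k. k(l := a)"])
    fix k k' :: "_ \<Rightarrow> 'a" assume m: "move ?D' k k'"
    then obtain c x where c: "circulation ?D' c" "\<forall>e\<in>arcs D - {l}. c e \<in> {- 1, 0, 1 :: int}"
      "\<forall>e\<in>arcs D - {l}. k' e = k e + int_scale (c e) x" by (auto simp: move_def)
    show "move D (k(l := a)) (k'(l := a))"
      unfolding move_def using m nz c circ_upd[of c 0]
      by (intro conjI exI[of _ "c(l := 0)"] exI[of _ x]) (auto simp: move_def)
  next
    fix f :: "_ \<Rightarrow> 'a" assume f: "nz_flow D f"
    then have f': "nz_flow ?D' f" using circ by (auto simp: nz_flow_def)
    have "circulation D (\<lambda>e. if e = l then 1 else 0 :: int)"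
      using boundary_single_arc[OF finite_arcs l(1), of "1::int"] l(2) by (simp add: circulation_def)
    then have "move D f (f(l := a))"
      unfolding move_def using f nz[OF f']
      by (intro conjI exI[of _ "\<lambda>e. if e = l then 1 else 0"] exI[of _ "a - f l"]) auto
    then show "\<exists>k. nz_flow ?D' k \<and> move D f (k(l := a))" using f' by blast
  qed
qed

text \<open>
  The head of the edge is merged into its tail. Edges parallel to it turn into loops.
\<close>

definition contract_arc :: "('v, 'e) pre_digraph \<Rightarrow> 'e \<Rightarrow> ('v, 'e) pre_digraph" where
  "contract_arc D e =
     (let \<pi> = (\<lambda>w. if w = head D e then tail D e else w)
      in \<lparr>verts = \<pi> ` verts D, arcs = arcs D - {e},
           tail = (\<lambda>d. \<pi> (tail D d)), head = (\<lambda>d. \<pi> (head D d))\<rparr>)"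

lemma contraction_contract_arc:
  "contraction (\<lambda>w. if w = head D e then tail D e else w) D (contract_arc D e)"
  by (auto simp: contraction_def contract_arc_def Let_def)

text \<open>
  Only the ends of \<open>e\<close> are in question, and their boundaries add up to zero because this sum is the
  boundary at the merged vertex. Exactly one of the two ends lies in \<open>X\<close>, where the total boundary
  vanishes by the choice of \<open>f e\<close>.
\<close>

lemma circulation_uncontract:
  fixes f :: "'e \<Rightarrow> 'b::ab_group_add"
  assumes "fin_digraph D" and X: "X \<subseteq> verts D" and cut: "cut D X = {e, e'}" and ne: "e \<noteq> e'"
    and f: "circulation (contract_arc D e) f"
    and fe: "f e = (if tail D e \<in> X \<longleftrightarrow> tail D e' \<in> X then - f e' else f e')"
  shows "circulation D f"
proof -
  interpret fin_digraph D by fact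
  let ?\<pi> = "\<lambda>w. if w = head D e then tail D e else w" and ?D' = "contract_arc D e"
  have c: "contraction ?\<pi> D ?D'" by (rule contraction_contract_arc)
  have e: "e \<in> arcs D" "(tail D e \<in> X) \<noteq> (head D e \<in> X)"
    using cut by (auto simp: cut_def)
  have uv: "tail D e \<in> verts D" "head D e \<in> verts D" "tail D e \<noteq> head D e" using e by auto
  have others: "boundary D f w = 0" if w: "w \<in> verts D" "w \<noteq> tail D e" "w \<noteq> head D e" for w
  proof -
    have "w \<in> verts ?D'" using w by (auto simp: contract_arc_def Let_def)
    then have "0 = boundary ?D' f w" using f by (simp add: circulation_def)
    also have "\<dots> = (\<Sum>z\<in>{z \<in> verts D. ?\<pi> z = w}. boundary D f z)"
      by (rule boundary_contraction[OF fin_digraph_axioms c])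
    also have "{z \<in> verts D. ?\<pi> z = w} = {w}" using w by auto
    finally show ?thesis by simp
  qed
  have "tail D e \<in> verts ?D'" using uv by (auto simp: contract_arc_def Let_def)
  then have "0 = boundary ?D' f (tail D e)" using f by (simp add: circulation_def)
  also have "\<dots> = (\<Sum>z\<in>{z \<in> verts D. ?\<pi> z = tail D e}. boundary D f z)"
    by (rule boundary_contraction[OF fin_digraph_axioms c])
  also have "{z \<in> verts D. ?\<pi> z = tail D e} = {tail D e, head D e}" using uv by auto
  finally have both: "boundary D f (tail D e) + boundary D f (head D e) = 0" using uv by simp
  have finX: "finite X" using X finite_verts finite_subset by blast
  have "(\<Sum>w\<in>X. boundary D f w) = 0"
    unfolding sum_boundary[OF finite_arcs finX] cut using ne fe by simp
  moreover have "(\<Sum>w\<in>X. boundary D f w) =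
      (\<Sum>w\<in>X \<inter> {tail D e, head D e}. boundary D f w)"
    using finX X others by (intro sum.mono_neutral_right) auto
  moreover have "X \<inter> {tail D e, head D e} = {tail D e} \<or> X \<inter> {tail D e, head D e} = {head D e}"
    using e(2) by auto
  ultimately have "boundary D f (tail D e) = 0 \<or> boundary D f (head D e) = 0" by auto
  then show ?thesis using both others unfolding circulation_def
    by (metis add.left_neutral add.right_neutral)
qed

text \<open>
  Across the cut \<open>{e, e'}\<close> the value on \<open>e\<close> is the value on \<open>e'\<close> up to a fixed sign, both for
  flows and for the coefficients of a move. So flows and moves of the contracted graph extend uniquely.
\<close>

lemma linked_flows_contract_arc:
  fixes D :: "('v, 'e) pre_digraph"
  assumes "fin_digraph D" and X: "X \<subseteq> verts D" and cut: "cut D X = {e, e'}" and ne: "e \<noteq> e'"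
    and linked: "linked_flows TYPE('a::ab_group_add) (contract_arc D e)"
  shows "linked_flows TYPE('a) D"
proof -
  interpret fin_digraph D by fact
  let ?D' = "contract_arc D e" and ?same = "tail D e \<in> X \<longleftrightarrow> tail D e' \<in> X"
  have arcs: "arcs ?D' = arcs D - {e}" by (simp add: contract_arc_def)
  have e: "e \<in> arcs D" "e' \<in> arcs D" using cut by (auto simp: cut_def)
  have circ: "circulation D (k(e := if ?same then - k e' else k e'))" if "circulation ?D' k"
    for k :: "'e \<Rightarrow> 'b::ab_group_add"
    using that ne circulation_cong[of ?D' k "k(e := if ?same then - k e' else k e')"] arcs
    by (intro circulation_uncontract[OF assms(1) X cut ne]) auto
  let ?P = "\<lambda>k :: 'e \<Rightarrow> 'a. k(e := if ?same then - k e' else k e')"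
  have nz: "nz_flow D (?P k)" if "nz_flow ?D' k" for k
    using that circ[of k] e ne arcs by (auto simp: nz_flow_def)
  show ?thesis
  proof (rule linked_flows_transfer[OF linked, where P = ?P])
    fix k k' :: "'e \<Rightarrow> 'a" assume m: "move ?D' k k'"
    then obtain c x where c: "circulation ?D' c" "\<forall>d\<in>arcs D - {e}. c d \<in> {- 1, 0, 1 :: int}"
      "\<forall>d\<in>arcs D - {e}. k' d = k d + int_scale (c d) x" by (auto simp: move_def arcs)
    let ?c = "c(e := if ?same then - c e' else c e')"
    have e': "c e' \<in> {- 1, 0, 1}" "k' e' = k e' + int_scale (c e') x" using c(2,3) e ne by auto
    show "move D (?P k) (?P k')"
      unfolding move_def
    proof (intro conjI exI[of _ ?c] exI[of _ x] ballI)
      show "nz_flow D (?P k)" "nz_flow D (?P k')" using m nz by (auto simp: move_def)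
      show "circulation D ?c" by (rule circ[OF c(1)])
      fix d assume d: "d \<in> arcs D"
      show "?c d \<in> {- 1, 0, 1}" using c(2) e'(1) d by auto
      show "?P k' d = ?P k d + int_scale (?c d) x" using c(3) e' d by auto
    qed
  next
    fix f :: "'e \<Rightarrow> 'a" assume f: "nz_flow D f"
    have "(if tail D e \<in> X then f e else - f e) + (if tail D e' \<in> X then f e' else - f e') = 0"
      using circulation_cut[OF assms(1) _ X, of f] f ne by (simp add: cut nz_flow_def)
    then have "f e = (if ?same then - f e' else f e')"
      by (auto simp: eq_neg_iff_add_eq_0 neg_eq_iff_add_eq_0 add.commute split: if_splits)
    then have "move D f (?P f)" by (intro move_eq_on_arcs[OF f]) auto
    moreover have "nz_flow ?D' f"
      by (rule nz_flow_contraction[OF assms(1) contraction_contract_arc f])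
    ultimately show "\<exists>k. nz_flow ?D' k \<and> move D f (?P k)" by blast
  qed
qed

text \<open>
  Removing a loop or contracting an edge of a two-edge cut loses an edge, so this ends.
\<close>

lemma ex_loopless_three_cut_connected:
  fixes D :: "('v, 'e) pre_digraph"
  assumes "fin_digraph D" "cut_connected 2 D" "\<not> linked_flows TYPE('a::ab_group_add) D"
  shows "\<exists>D' :: ('v, 'e) pre_digraph. fin_digraph D' \<and> loopless D' \<and> cut_connected 3 D' \<and>
    \<not> linked_flows TYPE('a) D'"
  using assms
proof (induction "card (arcs D)" arbitrary: D rule: less_induct)
  case less
  interpret fin_digraph D by fact
  show ?case
  proof (cases "loopless D")
    case False
    then obtain l where l: "l \<in> arcs D" "tail D l = head D l" by (auto simp: loopless_def)
    let ?D' = "D\<lparr>arcs := arcs D - {l}\<rparr>"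
    have "fin_digraph ?D'" by unfold_locales auto
    moreover have "cut ?D' X = cut D X" for X using l by (auto simp: cut_def)
    then have "cut_connected 2 ?D'" using less.prems(2) by (simp add: cut_connected_def)
    moreover have "\<not> linked_flows TYPE('a) ?D'"
      using linked_flows_delete_loop[OF less.prems(1) l] less.prems(3) by blast
    moreover have "card (arcs ?D') < card (arcs D)"
      using card_Diff1_less[OF finite_arcs l(1)] by simp
    ultimately show ?thesis using less.hyps by blast
  next
    case True
    show ?thesis
    proof (cases "cut_connected 3 D")
      case False
      then obtain X where X: "X \<subseteq> verts D" "X \<noteq> {}" "X \<noteq> verts D" "\<not> 3 \<le> card (cut D X)"
        using less.prems(2) by (auto simp: cut_connected_def)
      then have "card (cut D X) = 2" using cut_connectedD[OF less.prems(2) X(1-3)] by linarith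
      then obtain e e' where ee: "cut D X = {e, e'}" "e \<noteq> e'" by (meson card_2_iff)
      have e: "e \<in> arcs D" using ee by (auto simp: cut_def)
      let ?D' = "contract_arc D e"
      note c = contraction_contract_arc[of D e]
      have "\<not> linked_flows TYPE('a) ?D'"
        using linked_flows_contract_arc[OF less.prems(1) X(1) ee] less.prems(3) by blast
      moreover have "card (arcs ?D') < card (arcs D)"
        using card_Diff1_less[OF finite_arcs e] by (simp add: contract_arc_def)
      ultimately show ?thesis
        using less.hyps fin_digraph_contraction[OF less.prems(1) c]
          cut_connected_contraction[OF less.prems(1) c less.prems(2)] by blast
    qed (use less.prems True in blast)
  qed
qed

section \<open>Renaming vertices and edges\<close>

definition rename_digraph ::
  "('v \<Rightarrow> 'w) \<Rightarrow> ('e \<Rightarrow> 'd) \<Rightarrow> ('v, 'e) pre_digraph \<Rightarrow> ('w, 'd) pre_digraph" where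
  "rename_digraph \<kappa> \<iota> D =
     \<lparr>verts = \<kappa> ` verts D, arcs = \<iota> ` arcs D,
      tail = \<kappa> \<circ> tail D \<circ> inv_into (arcs D) \<iota>, head = \<kappa> \<circ> head D \<circ> inv_into (arcs D) \<iota>\<rparr>"

lemma
  fixes D :: "('v, 'e) pre_digraph" and \<kappa> :: "'v \<Rightarrow> 'w" and \<iota> :: "'e \<Rightarrow> 'd"
  assumes "fin_digraph D" and \<kappa>: "inj_on \<kappa> (verts D)" and \<iota>: "inj_on \<iota> (arcs D)"
  shows fin_digraph_rename: "fin_digraph (rename_digraph \<kappa> \<iota> D)"
    and loopless_rename: "loopless D \<Longrightarrow> loopless (rename_digraph \<kappa> \<iota> D)"
    and cut_connected_rename: "cut_connected k D \<Longrightarrow> cut_connected k (rename_digraph \<kappa> \<iota> D)"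
    and linked_flows_rename:
      "linked_flows TYPE('a::ab_group_add) (rename_digraph \<kappa> \<iota> D) \<Longrightarrow> linked_flows TYPE('a) D"
proof -
  interpret fin_digraph D by fact
  let ?R = "rename_digraph \<kappa> \<iota> D"
  have R: "verts ?R = \<kappa> ` verts D" "arcs ?R = \<iota> ` arcs D" by (simp_all add: rename_digraph_def)
  have ends: "tail ?R (\<iota> e) = \<kappa> (tail D e)" "head ?R (\<iota> e) = \<kappa> (head D e)" if "e \<in> arcs D" for e
    using \<iota> that by (simp_all add: rename_digraph_def)
  have \<kappa>_eq: "\<kappa> x = \<kappa> y \<longleftrightarrow> x = y" if "x \<in> verts D" "y \<in> verts D" for x y
    using \<kappa> that by (simp add: inj_on_eq_iff)
  show "fin_digraph ?R"
    by unfold_locales (auto simp: R ends)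
  show "loopless ?R" if "loopless D"
    unfolding loopless_def R using that by (auto simp: ends \<kappa>_eq loopless_def)
  show "cut_connected k ?R" if k: "cut_connected k D"
    unfolding cut_connected_def
  proof (intro conjI allI impI)
    show "verts ?R \<noteq> {}" using k by (simp add: R cut_connected_def)
    fix X assume X: "X \<subseteq> verts ?R" "X \<noteq> {}" "X \<noteq> verts ?R"
    let ?Y = "{w \<in> verts D. \<kappa> w \<in> X}"
    have "?Y \<noteq> {}" "?Y \<noteq> verts D" using X by (auto simp: R)
    then have "k \<le> card (cut D ?Y)" by (intro cut_connectedD[OF k]) auto
    also have "\<dots> = card (\<iota> ` cut D ?Y)"
      by (rule card_image[symmetric], rule inj_on_subset[OF \<iota>]) (auto simp: cut_def)
    also have "\<iota> ` cut D ?Y = cut ?R X"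
    proof -
      have "cut ?R X = \<iota> ` {e \<in> arcs D. (tail ?R (\<iota> e) \<in> X) \<noteq> (head ?R (\<iota> e) \<in> X)}"
        by (auto simp: cut_def R)
      also have "{e \<in> arcs D. (tail ?R (\<iota> e) \<in> X) \<noteq> (head ?R (\<iota> e) \<in> X)} = cut D ?Y"
        unfolding cut_def by (rule Collect_cong) (auto simp: ends)
      finally show ?thesis by simp
    qed
    finally show "k \<le> card (cut ?R X)" .
  qed
  have bd: "boundary ?R f (\<kappa> v) = boundary D (\<lambda>e. f (\<iota> e)) v" if "v \<in> verts D"
    for v and f :: "'d \<Rightarrow> 'b::ab_group_add"
    unfolding boundary_def R sum.reindex[OF \<iota>] using that
    by (intro sum.cong) (auto simp: ends \<kappa>_eq)
  have circ: "circulation ?R f \<longleftrightarrow> circulation D (\<lambda>e. f (\<iota> e))" for f :: "'d \<Rightarrow> 'b::ab_group_add"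
    by (auto simp: circulation_def R bd)
  have nz: "nz_flow ?R f \<longleftrightarrow> nz_flow D (\<lambda>e. f (\<iota> e))" for f :: "'d \<Rightarrow> 'b::ab_group_add"
    by (auto simp: nz_flow_def circ R)
  show "linked_flows TYPE('a) D" if L: "linked_flows TYPE('a) ?R"
  proof (rule linked_flows_transfer[OF L, where P = "\<lambda>k e. k (\<iota> e)"])
    fix k k' :: "'d \<Rightarrow> 'a" assume m: "move ?R k k'"
    then obtain c x where c: "circulation ?R c" "\<forall>e\<in>arcs D. c (\<iota> e) \<in> {- 1, 0, 1 :: int}"
      "\<forall>e\<in>arcs D. k' (\<iota> e) = k (\<iota> e) + int_scale (c (\<iota> e)) x" by (auto simp: move_def R)
    show "move D (\<lambda>e. k (\<iota> e)) (\<lambda>e. k' (\<iota> e))"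
      unfolding move_def
      by (intro conjI exI[of _ "\<lambda>e. c (\<iota> e)"] exI[of _ x])
        (use m c in \<open>auto simp: move_def nz circ\<close>)
  next
    fix f :: "'e \<Rightarrow> 'a" assume f: "nz_flow D f"
    let ?k = "\<lambda>d. f (inv_into (arcs D) \<iota> d)"
    have m: "move D f (\<lambda>e. ?k (\<iota> e))" by (rule move_eq_on_arcs[OF f]) (simp add: \<iota>)
    then have "nz_flow ?R ?k" by (simp add: move_def nz)
    then show "\<exists>k. nz_flow ?R k \<and> move D f (\<lambda>e. k (\<iota> e))" using m by blast
  qed
qed


section \<open>Expanding a vertex of degree at least four\<close>

text \<open>
  The vertex \<open>v\<close> is replaced by the directed 4-cycle \<open>c1, c2, c3, v\<close> with the edges
  \<open>a1, a2, a3, a4\<close> starting at these vertices in this order, and \<open>s1\<close>, \<open>s2\<close>, \<open>s3\<close> are moved from \<open>v\<close> to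
  \<open>c1\<close>, \<open>c2\<close>, \<open>c3\<close>. All other edges at \<open>v\<close> stay there.
\<close>

locale vertex_expansion = fin_digraph D for D :: "('v, 'e) pre_digraph" +
  fixes v c1 c2 c3 :: 'v and s1 s2 s3 a1 a2 a3 a4 :: 'e
  assumes v: "v \<in> verts D"
    and s: "s1 \<in> cut D {v}" "s2 \<in> cut D {v}" "s3 \<in> cut D {v}"
    and s_distinct: "s1 \<noteq> s2" "s1 \<noteq> s3" "s2 \<noteq> s3"
    and c: "c1 \<notin> verts D" "c2 \<notin> verts D" "c3 \<notin> verts D"
    and c_distinct: "c1 \<noteq> c2" "c1 \<noteq> c3" "c2 \<noteq> c3"
    and a: "a1 \<notin> arcs D" "a2 \<notin> arcs D" "a3 \<notin> arcs D" "a4 \<notin> arcs D"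
    and a_distinct: "distinct [a1, a2, a3, a4]"
begin

definition new_end :: "'e \<Rightarrow> 'v" where
  "new_end e = (if e = s1 then c1 else if e = s2 then c2 else if e = s3 then c3 else v)"

definition expansion :: "('v, 'e) pre_digraph" where
  "expansion =
     \<lparr>verts = verts D \<union> {c1, c2, c3},
      arcs = arcs D \<union> {a1, a2, a3, a4},
      tail = (\<lambda>e. if e = a1 then c1 else if e = a2 then c2 else if e = a3 then c3
        else if e = a4 then v else if tail D e = v then new_end e else tail D e),
      head = (\<lambda>e. if e = a1 then c2 else if e = a2 then c3 else if e = a3 then v
        else if e = a4 then c1 else if head D e = v then new_end e else head D e)\<rparr>"

lemma verts_expansion: "verts expansion = verts D \<union> {c1, c2, c3}"
  and arcs_expansion: "arcs expansion = arcs D \<union> {a1, a2, a3, a4}"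
  by (simp_all add: expansion_def)

lemma c_v: "c1 \<noteq> v" "c2 \<noteq> v" "c3 \<noteq> v"
  using v c by auto

lemma old_arc:
  assumes "e \<in> arcs D"
  shows "tail expansion e = (if tail D e = v then new_end e else tail D e)"
    and "head expansion e = (if head D e = v then new_end e else head D e)"
  using assms a by (auto simp: expansion_def)

lemma new_arc:
  "tail expansion a1 = c1" "tail expansion a2 = c2" "tail expansion a3 = c3" "tail expansion a4 = v"
  "head expansion a1 = c2" "head expansion a2 = c3" "head expansion a3 = v" "head expansion a4 = c1"
  using a_distinct by (auto simp: expansion_def)

lemma s_arcs: "s1 \<in> arcs D" "s2 \<in> arcs D" "s3 \<in> arcs D"
  using s by (auto simp: cut_def)

lemma new_end_s: "new_end s1 = c1" "new_end s2 = c2" "new_end s3 = c3"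
  using s_distinct by (auto simp: new_end_def)

lemma contraction_expansion:
  "contraction (\<lambda>w. if w \<in> {c1, c2, c3} then v else w) expansion D"
proof -
  let ?\<pi> = "\<lambda>w. if w \<in> {c1, c2, c3} then v else w"
  have V: "?\<pi> ` verts expansion = verts D"
    using v c by (force simp: verts_expansion)
  have old: "?\<pi> (tail expansion e) = tail D e \<and> ?\<pi> (head expansion e) = head D e"
    if "e \<in> arcs D" for e
  proof -
    have "tail D e \<notin> {c1, c2, c3}" "head D e \<notin> {c1, c2, c3}"
      using c that tail_in_verts head_in_verts by blast+
    moreover have "new_end e \<in> {c1, c2, c3} \<or> new_end e = v" by (simp add: new_end_def)
    ultimately show ?thesis unfolding old_arc[OF that] by auto
  qed
  have new: "?\<pi> (tail expansion e) = ?\<pi> (head expansion e)" if "e \<in> {a1, a2, a3, a4}" for e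
    using that unfolding insert_iff empty_iff by (elim disjE) (simp_all add: new_arc)
  show ?thesis
    unfolding contraction_def
  proof (intro conjI ballI)
    show "verts D = ?\<pi> ` verts expansion" by (rule V[symmetric])
    show "arcs D \<subseteq> arcs expansion" by (auto simp: arcs_expansion)
    show "tail D e = ?\<pi> (tail expansion e)" "head D e = ?\<pi> (head expansion e)" if "e \<in> arcs D" for e
      using old[OF that] by simp_all
    show "?\<pi> (tail expansion e) = ?\<pi> (head expansion e)" if "e \<in> arcs expansion - arcs D" for e
      using that unfolding arcs_expansion by (intro new) blast
  qed
qed

lemma fin_digraph_expansion: "fin_digraph expansion"
proof
  show "finite (verts expansion)" "finite (arcs expansion)"
    by (simp_all add: verts_expansion arcs_expansion)
  show "tail expansion e \<in> verts expansion" "head expansion e \<in> verts expansion"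
    if e: "e \<in> arcs expansion" for e
  proof -
    have n: "new_end e \<in> verts expansion" using v by (simp add: new_end_def verts_expansion)
    consider "e \<in> arcs D" | "e \<in> {a1, a2, a3, a4}" using e by (auto simp: arcs_expansion)
    then have "tail expansion e \<in> verts expansion \<and> head expansion e \<in> verts expansion"
    proof cases
      case 1
      then show ?thesis unfolding old_arc[OF 1] using n by (auto simp: verts_expansion)
    next
      case 2
      then show ?thesis using v unfolding insert_iff empty_iff
        by (elim disjE) (simp_all add: new_arc verts_expansion)
    qed
    then show "tail expansion e \<in> verts expansion" "head expansion e \<in> verts expansion" by auto
  qed
qed

lemma loopless_expansion:
  assumes "loopless D"
  shows "loopless expansion"
  unfolding loopless_def arcs_expansion
proof
  fix e assume "e \<in> arcs D \<union> {a1, a2, a3, a4}"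
  then consider "e \<in> arcs D" | "e \<in> {a1, a2, a3, a4}" by blast
  then show "tail expansion e \<noteq> head expansion e"
  proof cases
    case 1
    then have "tail D e \<noteq> head D e" using assms by (simp add: loopless_def)
    moreover have "tail D e \<notin> {c1, c2, c3}" "head D e \<notin> {c1, c2, c3}"
      using c 1 tail_in_verts head_in_verts by blast+
    ultimately show ?thesis unfolding old_arc[OF 1] by (auto simp: new_end_def)
  next
    case 2
    then show ?thesis using c_distinct c_v unfolding insert_iff empty_iff
      by (elim disjE) (simp_all add: new_arc)
  qed
qed

text \<open>
  For an edge with exactly one end at \<open>v\<close> this is its value when it is directed away from \<open>v\<close>.
\<close>

definition out_value :: "('e \<Rightarrow> 'b::ab_group_add) \<Rightarrow> 'e \<Rightarrow> 'b" where
  "out_value f e = (if tail D e = v then f e else - f e)"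

lemma boundary_new_vertex:
  fixes f :: "'e \<Rightarrow> 'b::ab_group_add"
  shows "boundary expansion f c1 = out_value f s1 + f a1 - f a4"
    and "boundary expansion f c2 = out_value f s2 + f a2 - f a1"
    and "boundary expansion f c3 = out_value f s3 + f a3 - f a2"
proof -
  have one: "boundary expansion f x = out_value f t +
      (\<Sum>e\<in>{a1, a2, a3, a4}. (if tail expansion e = x then f e else 0) - (if head expansion e = x then f e else 0))"
    if x: "x \<notin> verts D" and t: "t \<in> cut D {v}" and uniq: "\<And>e. new_end e = x \<longleftrightarrow> e = t" for x t
  proof -
    have tD: "t \<in> arcs D" and tv: "(tail D t = v) \<noteq> (head D t = v)" using t by (auto simp: cut_def)
    have ends: "tail expansion e = x \<longleftrightarrow> e = t \<and> tail D e = v"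
      "head expansion e = x \<longleftrightarrow> e = t \<and> head D e = v" if "e \<in> arcs D" for e
      unfolding old_arc[OF that] using uniq[of e] x that by auto
    have "(\<Sum>e\<in>arcs D. (if tail expansion e = x then f e else 0) - (if head expansion e = x then f e else 0))
        = (\<Sum>e\<in>arcs D. if e = t then out_value f t else 0)"
      using tv by (intro sum.cong) (auto simp: ends out_value_def)
    also have "\<dots> = out_value f t" using tD by simp
    finally show ?thesis
      unfolding boundary_def arcs_expansion using a by (subst sum.union_disjoint) auto
  qed
  have u: "new_end e = c1 \<longleftrightarrow> e = s1" "new_end e = c2 \<longleftrightarrow> e = s2" "new_end e = c3 \<longleftrightarrow> e = s3" for e
    using c_distinct c_v s_distinct by (auto simp: new_end_def)
  show "boundary expansion f c1 = out_value f s1 + f a1 - f a4"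
    unfolding one[OF c(1) s(1) u(1)] using a_distinct c_distinct c_v by (auto simp: new_arc)
  show "boundary expansion f c2 = out_value f s2 + f a2 - f a1"
    unfolding one[OF c(2) s(2) u(2)] using a_distinct c_distinct c_v by (auto simp: new_arc)
  show "boundary expansion f c3 = out_value f s3 + f a3 - f a2"
    unfolding one[OF c(3) s(3) u(3)] using a_distinct c_distinct c_v by (auto simp: new_arc)
qed

text \<open>
  Going round the 4-cycle, each edge differs from the previous one by the outward value of one
  \<open>s\<close>-edge, so the value \<open>y\<close> on \<open>a4\<close> determines the other three, and \<open>y\<close> has to avoid four group
  elements at most. The boundary at \<open>v\<close> then vanishes as well because the boundaries at the four
  cycle vertices add up to the boundary at \<open>v\<close> before the expansion.
\<close>

lemma nz_flow_lifts:
  fixes f :: "'e \<Rightarrow> 'a::{finite, ab_group_add}"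
  assumes A: "CARD('a) \<ge> 5" and f: "nz_flow D f"
  shows "\<exists>k. nz_flow expansion k \<and> (\<forall>e\<in>arcs D. k e = f e)"
proof -
  define b1 b2 b3 where "b1 = out_value f s1" and "b2 = out_value f s2" and "b3 = out_value f s3"
  have "card {0, b1, b1 + b2, b1 + b2 + b3} \<le> 4"
    by (rule order_trans[OF card_insert_le_m1[of 4]]) (auto intro!: card_insert_le_m1)
  then have "{0, b1, b1 + b2, b1 + b2 + b3} \<noteq> (UNIV :: 'a set)" using A by auto
  then obtain y where y: "y \<notin> {0, b1, b1 + b2, b1 + b2 + b3}" by blast
  define k where "k = f(a1 := y - b1, a2 := y - (b1 + b2), a3 := y - (b1 + b2 + b3), a4 := y)"
  have k_old: "k e = f e" if "e \<in> arcs D" for e using that a by (auto simp: k_def)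
  have k_new: "k a1 = y - b1" "k a2 = y - (b1 + b2)" "k a3 = y - (b1 + b2 + b3)" "k a4 = y"
    using a_distinct by (auto simp: k_def)
  have out: "out_value k e = out_value f e" if "e \<in> arcs D" for e
    by (simp add: out_value_def k_old that)
  have bc: "boundary expansion k c1 = 0" "boundary expansion k c2 = 0" "boundary expansion k c3 = 0"
    unfolding boundary_new_vertex k_new out[OF s_arcs(1)] out[OF s_arcs(2)] out[OF s_arcs(3)]
    by (simp_all add: b1_def b2_def b3_def)
  have bold: "boundary expansion k w = 0" if w: "w \<in> verts D" for w
  proof -
    let ?\<pi> = "\<lambda>w. if w \<in> {c1, c2, c3} then v else w"
    let ?W = "{z \<in> verts expansion. ?\<pi> z = w}"
    have "circulation D k" using f circulation_cong[of D k f] k_old by (simp add: nz_flow_def)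
    then have "0 = boundary D k w" using w by (simp add: circulation_def)
    also have "\<dots> = (\<Sum>z\<in>?W. boundary expansion k z)"
      by (rule boundary_contraction[OF fin_digraph_expansion contraction_expansion])
    also have "\<dots> = (\<Sum>z\<in>{w}. boundary expansion k z)"
    proof (rule sum.mono_neutral_right)
      show "finite ?W" by (simp add: verts_expansion)
      have "w \<notin> {c1, c2, c3}" using w c by auto
      then show "{w} \<subseteq> ?W" using w by (simp add: verts_expansion)
      show "\<forall>z\<in>?W - {w}. boundary expansion k z = 0" using bc by (auto split: if_splits)
    qed
    finally show ?thesis by simp
  qed
  have "circulation expansion k" using bc bold by (auto simp: circulation_def verts_expansion)
  moreover have "k e \<noteq> 0" if "e \<in> arcs expansion" for e
    using that f y k_old k_new by (auto simp: arcs_expansion nz_flow_def)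
  ultimately show ?thesis using k_old by (auto simp: nz_flow_def)
qed

lemma linked_flows_expansion:
  assumes A: "CARD('a::{finite, ab_group_add}) \<ge> 5" and L: "linked_flows TYPE('a) expansion"
  shows "linked_flows TYPE('a) D"
proof (rule linked_flows_transfer[OF L, where P = "\<lambda>k. k"])
  show "move D k k'" if "move expansion k k'" for k k' :: "'e \<Rightarrow> 'a"
    by (rule move_contraction[OF fin_digraph_expansion contraction_expansion that])
  fix f :: "'e \<Rightarrow> 'a" assume f: "nz_flow D f"
  then obtain k where "nz_flow expansion k" "\<forall>e\<in>arcs D. k e = f e" using nz_flow_lifts[OF A] by blast
  then show "\<exists>k. nz_flow expansion k \<and> move D f k" using move_eq_on_arcs[OF f, of k] by auto
qed

text \<open>
  Let \<open>X\<close> omit \<open>v\<close> and define a cut with fewer than three edges. If \<open>X\<close> contains none of the new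
  vertices, it already defines this cut in \<open>D\<close>. Otherwise the 4-cycle crosses the cut at least
  twice, so nothing else crosses it. Back in \<open>D\<close> the old vertices of \<open>X\<close> are then
  separated from the rest by some of \<open>s1\<close>, \<open>s2\<close>, \<open>s3\<close> only, hence by exactly these three.
\<close>

lemma cut_connected_expansion:
  assumes k: "cut_connected 3 D" and no_cut: "\<And>X. X \<subseteq> verts D - {v} \<Longrightarrow> cut D X \<noteq> {s1, s2, s3}"
  shows "cut_connected 3 expansion"
proof -
  interpret E: fin_digraph expansion by (rule fin_digraph_expansion)
  have away: "3 \<le> card (cut expansion X)"
    if X: "X \<subseteq> verts expansion" "X \<noteq> {}" "v \<notin> X" for X
  proof (cases "X \<inter> {c1, c2, c3} = {}")
    case True
    have XD: "X \<subseteq> verts D" using X True by (auto simp: verts_expansion)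
    have "new_end e \<notin> X" for e using True X(3) by (auto simp: new_end_def)
    then have "tail expansion e \<in> X \<longleftrightarrow> tail D e \<in> X" "head expansion e \<in> X \<longleftrightarrow> head D e \<in> X"
      if "e \<in> arcs D" for e
      unfolding old_arc[OF that] using X(3) by simp_all
    then have "cut D X \<subseteq> cut expansion X"
      by (auto simp: cut_def arcs_expansion)
    then have "card (cut D X) \<le> card (cut expansion X)"
      by (intro card_mono finite_cut) auto
    moreover have "3 \<le> card (cut D X)" using XD X v by (intro cut_connectedD[OF k]) auto
    ultimately show ?thesis by linarith
  next
    case False
    show ?thesis
    proof (rule ccontr)
      assume small: "\<not> 3 \<le> card (cut expansion X)"
      have new_cut: "a1 \<in> cut expansion X \<longleftrightarrow> (c1 \<in> X) \<noteq> (c2 \<in> X)"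
        "a2 \<in> cut expansion X \<longleftrightarrow> (c2 \<in> X) \<noteq> (c3 \<in> X)"
        "a3 \<in> cut expansion X \<longleftrightarrow> c3 \<in> X" "a4 \<in> cut expansion X \<longleftrightarrow> c1 \<in> X"
        using X(3) by (simp_all add: cut_def arcs_expansion new_arc)
      obtain p q where pq: "p \<in> cut expansion X" "q \<in> cut expansion X" "p \<noteq> q"
        "p \<notin> arcs D" "q \<notin> arcs D"
      proof -
        consider "c1 \<in> X" "c3 \<in> X" | "c1 \<in> X" "c2 \<in> X" "c3 \<notin> X" | "c1 \<in> X" "c2 \<notin> X" "c3 \<notin> X"
          | "c1 \<notin> X" "c2 \<in> X" "c3 \<in> X" | "c1 \<notin> X" "c2 \<in> X" "c3 \<notin> X" | "c1 \<notin> X" "c2 \<notin> X" "c3 \<in> X"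
          using False by blast
        then show ?thesis
        proof cases
          case 1 then show ?thesis using that[of a3 a4] new_cut a a_distinct by auto
        next
          case 2 then show ?thesis using that[of a2 a4] new_cut a a_distinct by auto
        next
          case 3 then show ?thesis using that[of a1 a4] new_cut a a_distinct by auto
        next
          case 4 then show ?thesis using that[of a1 a3] new_cut a a_distinct by auto
        next
          case 5 then show ?thesis using that[of a1 a2] new_cut a a_distinct by auto
        next
          case 6 then show ?thesis using that[of a2 a3] new_cut a a_distinct by auto
        qed
      qed
      have uncut: "e \<notin> cut expansion X" if "e \<in> arcs D" for e
      proof
        assume "e \<in> cut expansion X"
        then have "card {p, q, e} \<le> card (cut expansion X)"
          using pq by (intro card_mono finite_cut) auto
        moreover have "card {p, q, e} = 3" using pq that by (auto simp: card_insert_if)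
        ultimately show False using small by linarith
      qed
      define X0 where "X0 = X \<inter> verts D"
      have sub: "cut D X0 \<subseteq> {s1, s2, s3}"
      proof
        fix e assume e: "e \<in> cut D X0"
        then have eD: "e \<in> arcs D" by (simp add: cut_def)
        show "e \<in> {s1, s2, s3}"
        proof (rule ccontr)
          assume "e \<notin> {s1, s2, s3}"
          then have "new_end e = v" by (simp add: new_end_def)
          then have "tail expansion e = tail D e" "head expansion e = head D e"
            unfolding old_arc[OF eD] by auto
          then have "e \<in> cut expansion X" using e eD by (auto simp: cut_def X0_def arcs_expansion)
          then show False using uncut[OF eD] by blast
        qed
      qed
      have "X0 \<noteq> {}"
      proof -
        obtain t where t: "t \<in> cut D {v}" "new_end t \<in> X"
          using False s new_end_s by auto
        have tD: "t \<in> arcs D" and tv: "(tail D t = v) \<noteq> (head D t = v)" using t by (auto simp: cut_def)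
        have "t \<notin> cut expansion X" by (rule uncut[OF tD])
        then have "tail D t \<in> X \<or> head D t \<in> X"
          using tv t(2) tD by (auto simp: cut_def old_arc arcs_expansion split: if_splits)
        then show ?thesis using tD by (auto simp: X0_def)
      qed
      moreover have "X0 \<subseteq> verts D" "X0 \<noteq> verts D" using X(3) v by (auto simp: X0_def)
      ultimately have "3 \<le> card (cut D X0)" by (intro cut_connectedD[OF k])
      moreover have "card {s1, s2, s3} = 3" using s_distinct by simp
      ultimately have "cut D X0 = {s1, s2, s3}" using sub by (intro card_seteq) auto
      moreover have "X0 \<subseteq> verts D - {v}" using X(3) by (auto simp: X0_def)
      ultimately show False using no_cut by blast
    qed
  qed
  show ?thesis
    unfolding cut_connected_def
  proof (intro conjI allI impI)
    show "verts expansion \<noteq> {}" by (simp add: verts_expansion)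
    fix X assume X: "X \<subseteq> verts expansion" "X \<noteq> {}" "X \<noteq> verts expansion"
    show "3 \<le> card (cut expansion X)"
    proof (cases "v \<in> X")
      case True
      have "3 \<le> card (cut expansion (verts expansion - X))" using X True by (intro away) auto
      then show ?thesis by (simp add: cut_Compl[OF fin_digraph_expansion])
    qed (use X away in blast)
  qed
qed

end

text \<open>
  If \<open>s1, s2, s3\<close> and \<open>s1, s2, s4\<close> were both edge cuts, then so would be \<open>s3, s4\<close>, by taking the
  symmetric difference of the sides that omit \<open>v\<close>.
\<close>

lemma ex_three_arcs_not_a_cut:
  assumes "fin_digraph D" and k: "cut_connected 3 D" and v: "v \<in> verts D" and deg: "4 \<le> card (cut D {v})"
  obtains s1 s2 s3 where "s1 \<in> cut D {v}" "s2 \<in> cut D {v}" "s3 \<in> cut D {v}"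
    "s1 \<noteq> s2" "s1 \<noteq> s3" "s2 \<noteq> s3" "\<And>X. X \<subseteq> verts D - {v} \<Longrightarrow> cut D X \<noteq> {s1, s2, s3}"
proof -
  interpret fin_digraph D by fact
  obtain T where T: "T \<subseteq> cut D {v}" "card T = 4" using obtain_subset_with_card_n[OF deg] by blast
  then obtain s1 s2 s3 s4 where "T = {s1, s2, s3, s4}" "distinct [s1, s2, s3, s4]"
    by (auto simp: eval_nat_numeral card_Suc_eq)
  then have s: "s1 \<in> cut D {v}" "s2 \<in> cut D {v}" "s3 \<in> cut D {v}" "s4 \<in> cut D {v}"
    and d: "s1 \<noteq> s2" "s1 \<noteq> s3" "s2 \<noteq> s3" "s1 \<noteq> s4" "s2 \<noteq> s4" "s3 \<noteq> s4" using T by auto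
  have "\<not> (\<exists>X \<subseteq> verts D - {v}. cut D X = {s1, s2, s3}) \<or> \<not> (\<exists>X \<subseteq> verts D - {v}. cut D X = {s1, s2, s4})"
  proof (rule ccontr)
    assume "\<not> ?thesis"
    then obtain X Y where X: "X \<subseteq> verts D - {v}" "cut D X = {s1, s2, s3}"
      and Y: "Y \<subseteq> verts D - {v}" "cut D Y = {s1, s2, s4}" by blast
    let ?Z = "(X - Y) \<union> (Y - X)"
    have "cut D ?Z = (cut D X - cut D Y) \<union> (cut D Y - cut D X)" unfolding cut_def by blast
    also have "\<dots> = {s3, s4}" unfolding X Y using d by auto
    finally have "card (cut D ?Z) = 2" using d by simp
    moreover have "X \<noteq> Y" using X(2) Y(2) d by auto
    then have "3 \<le> card (cut D ?Z)" using X(1) Y(1) v by (intro cut_connectedD[OF k]) auto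
    ultimately show False by simp
  qed
  then show ?thesis
  proof
    assume "\<not> (\<exists>X \<subseteq> verts D - {v}. cut D X = {s1, s2, s3})"
    then show ?thesis using that[of s1 s2 s3] s d by blast
  next
    assume "\<not> (\<exists>X \<subseteq> verts D - {v}. cut D X = {s1, s2, s4})"
    then show ?thesis using that[of s1 s2 s4] s d by blast
  qed
qed

lemma loopless_handshake:
  assumes "fin_digraph D" "loopless D"
  shows "(\<Sum>v\<in>verts D. card (cut D {v})) = 2 * card (arcs D)"
proof -
  interpret fin_digraph D by fact
  have "card (cut D {v}) = (\<Sum>e\<in>arcs D. (if tail D e = v then 1 else 0) + (if head D e = v then 1 else 0))"
    for v
  proof -
    have "card (cut D {v}) = (\<Sum>e\<in>cut D {v}. 1)" by simp
    also have "\<dots> = (\<Sum>e\<in>arcs D. (if tail D e = v then 1 else 0) + (if head D e = v then 1 else 0))"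
      using assms(2) by (intro sum.mono_neutral_cong_left) (auto simp: cut_def loopless_def)
    finally show ?thesis .
  qed
  then have "(\<Sum>v\<in>verts D. card (cut D {v})) = (\<Sum>v\<in>verts D. \<Sum>e\<in>arcs D.
      (if tail D e = v then 1 else 0) + (if head D e = v then 1 else 0))" by simp
  also have "\<dots> = (\<Sum>e\<in>arcs D. \<Sum>v\<in>verts D.
      (if tail D e = v then 1 else 0) + (if head D e = v then 1 else 0))" by (rule sum.swap)
  also have "\<dots> = (\<Sum>e\<in>arcs D. 2)"
    by (intro sum.cong refl) (simp add: sum.distrib)
  finally show ?thesis by simp
qed

text \<open>
  The handshake lemma and minimum degree three make \<open>2|E| - 3|V|\<close> nonnegative, and even positive as
  long as there is a vertex to expand; so truncated subtraction is harmless in the induction measure.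
\<close>

lemma ex_cubic_digraph:
  fixes D :: "(nat, nat) pre_digraph"
  assumes A: "CARD('a::{finite, ab_group_add}) \<ge> 5"
    and "fin_digraph D" "loopless D" "cut_connected 3 D" "\<not> linked_flows TYPE('a) D"
  shows "\<exists>D' :: (nat, nat) pre_digraph. fin_digraph D' \<and> loopless D' \<and> cut_connected 3 D' \<and>
    \<not> linked_flows TYPE('a) D' \<and> card (verts D') \<ge> 2 \<and> (\<forall>v\<in>verts D'. card (cut D' {v}) = 3)"
  using assms(2-)
proof (induction "2 * card (arcs D) - 3 * card (verts D)" arbitrary: D rule: less_induct)
  case less
  interpret fin_digraph D by fact
  have two: "2 \<le> card (verts D)"
  proof (rule ccontr)
    assume "\<not> 2 \<le> card (verts D)"
    moreover have "card (verts D) \<noteq> 0" using less.prems(3) by (simp add: cut_connected_def)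
    ultimately have "card (verts D) = 1" by linarith
    then obtain u where "verts D = {u}" by (rule card_1_singletonE)
    then have "arcs D = {}"
      using less.prems(2) tail_in_verts head_in_verts unfolding loopless_def
      by (metis equals0I singletonD)
    then have "linked_flows TYPE('a) D"
      by (auto simp: linked_flows_def intro: move_eq_on_arcs)
    then show False using less.prems(4) by blast
  qed
  have deg: "3 \<le> card (cut D {v})" if "v \<in> verts D" for v
  proof -
    have "verts D \<noteq> {v}" using two by auto
    then show ?thesis using that by (intro cut_connectedD[OF less.prems(3)]) auto
  qed
  show ?case
  proof (cases "\<forall>v\<in>verts D. card (cut D {v}) = 3")
    case True
    then show ?thesis using less.prems two by blast
  next
    case False
    then obtain v where v: "v \<in> verts D" "card (cut D {v}) \<noteq> 3" by blast
    then have v4: "4 \<le> card (cut D {v})" using deg[of v] by linarith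
    obtain s1 s2 s3 where s: "s1 \<in> cut D {v}" "s2 \<in> cut D {v}" "s3 \<in> cut D {v}"
      "s1 \<noteq> s2" "s1 \<noteq> s3" "s2 \<noteq> s3"
      and no_cut: "\<And>X. X \<subseteq> verts D - {v} \<Longrightarrow> cut D X \<noteq> {s1, s2, s3}"
      using ex_three_arcs_not_a_cut[OF less.prems(1,3) v(1) v4] by metis
    have "infinite (- verts D)" "infinite (- arcs D)" by (simp_all add: finite_compl)
    then obtain C B where CB: "card C = 3" "C \<subseteq> - verts D" "card B = 4" "B \<subseteq> - arcs D"
      using infinite_arbitrarily_large by metis
    then have C: "verts D \<inter> C = {}" "finite C" "card C = 3" and B: "arcs D \<inter> B = {}" "finite B" "card B = 4"
      by (auto intro: card_ge_0_finite)
    from C(3) obtain c1 c2 c3 where c: "C = {c1, c2, c3}" "c1 \<noteq> c2" "c1 \<noteq> c3" "c2 \<noteq> c3"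
      by (auto simp: card_3_iff)
    from B(3) obtain a1 a2 a3 a4 where a: "B = {a1, a2, a3, a4}" "distinct [a1, a2, a3, a4]"
      by (auto simp: eval_nat_numeral card_Suc_eq)
    interpret X: vertex_expansion D v c1 c2 c3 s1 s2 s3 a1 a2 a3 a4
      by unfold_locales (use v(1) s c a B C in auto)
    let ?E = X.expansion
    have cards: "card (verts ?E) = card (verts D) + 3" "card (arcs ?E) = card (arcs D) + 4"
      unfolding X.verts_expansion X.arcs_expansion
      using card_Un_disjoint[OF finite_verts C(2,1)] card_Un_disjoint[OF finite_arcs B(2,1)] B(3) C(3)
      unfolding a(1) c(1) by simp_all
    have "(\<Sum>w\<in>verts D. 3) < (\<Sum>w\<in>verts D. card (cut D {w}))"
      using deg v(1) v4 by (intro sum_strict_mono_ex1 bexI[of _ v]) auto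
    then have "3 * card (verts D) < 2 * card (arcs D)"
      using loopless_handshake[OF less.prems(1,2)] by simp
    then have "2 * card (arcs ?E) - 3 * card (verts ?E) < 2 * card (arcs D) - 3 * card (verts D)"
      unfolding cards by simp
    moreover have "\<not> linked_flows TYPE('a) ?E"
      using X.linked_flows_expansion[OF A] less.prems(4) by blast
    ultimately show ?thesis
      using less.hyps X.fin_digraph_expansion X.loopless_expansion[OF less.prems(2)]
        X.cut_connected_expansion[OF less.prems(3) no_cut] by blast
  qed
qed

section \<open>Cubic graphs\<close>

text \<open>
  A flow is given by the values \<open>a\<close>, \<open>b\<close> on two of the edges, all edges being directed from \<open>u\<close> to
  \<open>w\<close>, with \<open>a\<close>, \<open>b\<close> and \<open>a + b\<close> nonzero. Two edges form a cycle, so any two flows that agree on one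
  edge differ by a move. Then \<open>(a, b)\<close> moves to \<open>(a', b')\<close> through \<open>(a, z)\<close> and \<open>(a', z)\<close>, where
  \<open>z\<close> avoids \<open>0\<close>, \<open>-a\<close> and \<open>-a'\<close>.
\<close>

lemma linked_flows_theta:
  fixes D :: "('v, 'e) pre_digraph"
  assumes A: "CARD('a::{finite, ab_group_add}) \<ge> 5"
    and "fin_digraph D" "loopless D" and V: "verts D = {u, w}" and three: "card (arcs D) = 3"
  shows "linked_flows TYPE('a) D"
proof -
  interpret fin_digraph D by fact
  have ends: "(tail D e = u \<and> head D e = w \<or> tail D e = w \<and> head D e = u) \<and> u \<noteq> w"
    if "e \<in> arcs D" for e
    using assms(3) tail_in_verts[OF that] head_in_verts[OF that] that unfolding V loopless_def by auto
  \<comment> \<open>the value in the direction from \<open>u\<close> to \<open>w\<close>\<close>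
  define val where "val f e = (if tail D e = u then f e else - f e)" for f :: "'e \<Rightarrow> 'a" and e
  have circ: "circulation D f \<longleftrightarrow> (\<Sum>e\<in>arcs D. if tail D e = u then f e else - f e) = 0"
    for f :: "'e \<Rightarrow> 'b::ab_group_add"
  proof -
    have bu: "boundary D f u = (\<Sum>e\<in>arcs D. if tail D e = u then f e else - f e)"
      unfolding boundary_def using ends by (intro sum.cong refl) force
    have bw: "boundary D f w = - (\<Sum>e\<in>arcs D. if tail D e = u then f e else - f e)"
      unfolding boundary_def sum_negf[symmetric] using ends by (intro sum.cong refl) force
    show ?thesis by (simp add: circulation_def V bu bw)
  qed
  have val_0: "val f e = 0 \<longleftrightarrow> f e = 0" for f e by (simp add: val_def)
  have nz_iff: "nz_flow D f \<longleftrightarrow> val f d1 + val f d2 + val f d3 = 0 \<and>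
      val f d1 \<noteq> 0 \<and> val f d2 \<noteq> 0 \<and> val f d3 \<noteq> 0"
    if "arcs D = {d1, d2, d3}" "d1 \<noteq> d2" "d1 \<noteq> d3" "d2 \<noteq> d3" for f d1 d2 d3
  proof -
    have "(\<Sum>e\<in>arcs D. if tail D e = u then f e else - f e) = val f d1 + val f d2 + val f d3"
      unfolding that(1) using that(2-4) by (simp add: val_def add.assoc)
    then show ?thesis unfolding nz_flow_def circ val_0 using that(1) by auto
  qed
  have agree: "move D f g"
    if d: "arcs D = {d1, d2, d3}" "d1 \<noteq> d2" "d1 \<noteq> d3" "d2 \<noteq> d3"
      and f: "nz_flow D f" and g: "nz_flow D g" and eq: "val g d3 = val f d3" for f g d1 d2 d3
  proof -
    let ?s = "\<lambda>e. if tail D e = u then 1 else - 1 :: int"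
    define c where "c e = (if e = d1 then ?s e else if e = d2 then - ?s e else 0)" for e
    have circ_c: "circulation D c" unfolding circ d(1) using d(2-4) by (auto simp: c_def)
    have "val g d1 + val g d2 = val f d1 + val f d2"
      using f g eq unfolding nz_iff[OF d] by (metis add_right_imp_eq)
    then have x2: "val g d2 = val f d2 - (val g d1 - val f d1)" by (simp add: algebra_simps)
    define x where "x = val g d1 - val f d1"
    have diffs: "val g d1 = val f d1 + x" "val g d2 = val f d2 - x"
      using x2 by (simp_all add: x_def)
    have c: "c d1 = ?s d1" "c d2 = - ?s d2" "c d3 = 0" using d(2-4) by (auto simp: c_def)
    have pos: "val h e = h e" if "tail D e = u" for h e using that by (simp add: val_def)
    have neg: "val h e = - h e" if "tail D e \<noteq> u" for h e using that by (simp add: val_def)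
    have flip: "a = b - y" if "- a = - b + y" for a b y :: 'a
      using arg_cong[OF that, of uminus] by simp
    have "g d1 = f d1 + int_scale (c d1) x"
      using diffs(1) flip[of "g d1" "f d1" x] c(1) by (cases "tail D d1 = u") (simp_all add: pos neg)
    moreover have "g d2 = f d2 + int_scale (c d2) x"
      using diffs(2) flip[of "g d2" "f d2" "- x"] c(2) by (cases "tail D d2 = u") (simp_all add: pos neg)
    moreover have "g d3 = f d3 + int_scale (c d3) x"
      using eq c(3) by (cases "tail D d3 = u") (simp_all add: pos neg)
    ultimately have "\<forall>e\<in>arcs D. g e = f e + int_scale (c e) x" unfolding d(1) by blast
    moreover have "\<forall>e\<in>arcs D. c e \<in> {- 1, 0, 1}" by (simp add: c_def)
    ultimately show ?thesis unfolding move_def using f g circ_c by blast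
  qed
  obtain e1 e2 e3 where e: "arcs D = {e1, e2, e3}" "e1 \<noteq> e2" "e1 \<noteq> e3" "e2 \<noteq> e3"
    using three by (auto simp: card_3_iff)
  have e': "arcs D = {e2, e3, e1}" "arcs D = {e1, e3, e2}" using e(1) by auto
  define F where "F a b e = (let r = if e = e1 then a else if e = e2 then b else - (a + b)
      in if tail D e = u then r else - r)" for a b :: 'a and e
  have valF: "val (F a b) e1 = a" "val (F a b) e2 = b" "val (F a b) e3 = - (a + b)" for a b
    using e(2-4) by (simp_all add: val_def F_def Let_def)
  have nzF: "nz_flow D (F a b) \<longleftrightarrow> a \<noteq> 0 \<and> b \<noteq> 0 \<and> a + b \<noteq> 0" for a b
    unfolding nz_iff[OF e] valF by (simp only: add.right_inverse neg_equal_0_iff_equal simp_thms)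
  show ?thesis
    unfolding linked_flows_def
  proof (intro allI impI)
    fix f g :: "'e \<Rightarrow> 'a" assume f: "nz_flow D f" and g: "nz_flow D g"
    define a b a' b' where "a = val f e1" and "b = val f e2" and "a' = val g e1" and "b' = val g e2"
    have f3: "val f e3 = - (a + b)" "a \<noteq> 0" "b \<noteq> 0" "a + b \<noteq> 0"
      using f unfolding nz_iff[OF e] a_def b_def by (auto simp: add_eq_0_iff)
    have g3: "val g e3 = - (a' + b')" "a' \<noteq> 0" "b' \<noteq> 0" "a' + b' \<noteq> 0"
      using g unfolding nz_iff[OF e] a'_def b'_def by (auto simp: add_eq_0_iff)
    have "card {0, - a, - a'} \<le> 3"
      by (rule order_trans[OF card_insert_le_m1[of 3]]) (auto intro!: card_insert_le_m1)
    then have "{0, - a, - a'} \<noteq> (UNIV :: 'a set)" using A by auto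
    then obtain z where z: "z \<noteq> 0" "z \<noteq> - a" "z \<noteq> - a'" by blast
    then have az: "a + z \<noteq> 0" "a' + z \<noteq> 0" by (auto simp: add_eq_0_iff)
    have nz: "nz_flow D (F a b)" "nz_flow D (F a z)" "nz_flow D (F a' z)" "nz_flow D (F a' b')"
      unfolding nzF using f3 g3 z az by auto
    have "move D f (F a b)"
      using agree[OF e f nz(1)] valF f3(1) by simp
    moreover have "move D (F a b) (F a z)"
      by (rule agree[OF e'(1) _ _ _ nz(1,2)]) (use e valF in auto)
    moreover have "move D (F a z) (F a' z)"
      by (rule agree[OF e'(2) _ _ _ nz(2,3)]) (use e valF in auto)
    moreover have "move D (F a' z) (F a' b')"
      by (rule agree[OF e'(1) _ _ _ nz(3,4)]) (use e valF in auto)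
    moreover have "move D (F a' b') g"
      using agree[OF e nz(4) g] valF g3(1) by simp
    ultimately show "(move D)\<^sup>*\<^sup>* f g"
      by (meson converse_rtranclp_into_rtranclp rtranclp.rtrancl_refl)
  qed
qed

definition underlying :: "('v, 'e) pre_digraph \<Rightarrow> ('v, 'e) mgraph" where
  "underlying D = \<lparr>vertices = verts D, edges = arcs D, ends = (\<lambda>e. {tail D e, head D e})\<rparr>"

lemma underlying_simps:
  "vertices (underlying D) = verts D" "edges (underlying D) = arcs D"
  "ends (underlying D) e = {tail D e, head D e}"
  by (simp_all add: underlying_def)

lemma multigraph_underlying:
  assumes "fin_digraph D"
  shows "multigraph (underlying D)"
proof -
  interpret fin_digraph D by fact
  show ?thesis by (auto simp: multigraph_def underlying_simps card_insert_if)
qed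

lemma orientation_underlying: "orientation (underlying D) D"
  by (simp add: orientation_def underlying_simps)

lemma cubic_underlying:
  assumes "loopless D" "\<forall>v\<in>verts D. card (cut D {v}) = 3"
  shows "cubic (underlying D)"
  unfolding regular_mgraph_def underlying_simps
proof
  fix v assume v: "v \<in> verts D"
  have I: "{e \<in> arcs D. v \<in> {tail D e, head D e}} = cut D {v}"
    using assms(1) by (auto simp: cut_def loopless_def)
  have L: "{e \<in> arcs D. {tail D e, head D e} = {v}} = {}"
    using assms(1) by (auto simp: loopless_def)
  show "degree (underlying D) v = 3"
    using assms(2) v unfolding degree_def underlying_simps I L by simp
qed

text \<open>
  Two parallel edges use up all but one edge at each of their ends, so at most two edges leave the
  pair of ends, although there are other vertices.
\<close>

lemma simple_underlying:
  assumes "fin_digraph D" "loopless D" "cut_connected 3 D" "\<forall>v\<in>verts D. card (cut D {v}) = 3"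
    and big: "card (verts D) > 2"
  shows "simple_mgraph (underlying D)"
proof -
  interpret fin_digraph D by fact
  have "card {tail D e, head D e} = 2" if "e \<in> arcs D" for e
    using that assms(2) by (auto simp: loopless_def)
  moreover have "inj_on (\<lambda>e. {tail D e, head D e}) (arcs D)"
  proof (rule inj_onI, rule ccontr)
    fix d e assume de: "d \<in> arcs D" "e \<in> arcs D" "{tail D d, head D d} = {tail D e, head D e}" "d \<noteq> e"
    let ?u = "tail D d" and ?w = "head D d"
    have uw: "?u \<noteq> ?w" "?u \<in> verts D" "?w \<in> verts D" using de assms(2) by (auto simp: loopless_def)
    have te: "tail D e = ?u \<and> head D e = ?w \<or> tail D e = ?w \<and> head D e = ?u"
      using de(3) by (auto simp: doubleton_eq_iff)
    have both: "{d, e} \<subseteq> cut D {?u}" "{d, e} \<subseteq> cut D {?w}"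
      using de(1,2) uw(1) te by (auto simp: cut_def)
    have one: "card (cut D {x} - {d, e}) = 1" if "x \<in> {?u, ?w}" for x
    proof -
      have "{d, e} \<subseteq> cut D {x}" "card (cut D {x}) = 3" using that both uw assms(4) by auto
      then show ?thesis using de(4) by (simp add: card_Diff_subset)
    qed
    have "cut D {?u, ?w} \<subseteq> (cut D {?u} - {d, e}) \<union> (cut D {?w} - {d, e})"
      using te by (auto simp: cut_def)
    then have "card (cut D {?u, ?w}) \<le> card ((cut D {?u} - {d, e}) \<union> (cut D {?w} - {d, e}))"
      by (intro card_mono) (auto simp: finite_cut)
    also have "\<dots> \<le> 2" using card_Un_le[of "cut D {?u} - {d, e}" "cut D {?w} - {d, e}"] one by simp
    finally have "card (cut D {?u, ?w}) \<le> 2" .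
    moreover have "{?u, ?w} \<noteq> verts D"
    proof
      assume "{?u, ?w} = verts D"
      then have "card (verts D) = 2" using uw(1) by (metis card_2_iff)
      then show False using big by simp
    qed
    then have "3 \<le> card (cut D {?u, ?w})" using uw by (intro cut_connectedD[OF assms(3)]) auto
    ultimately show False by simp
  qed
  ultimately show ?thesis by (simp add: simple_mgraph_def underlying_def)
qed

text \<open>
  If the deletion of \<open>x\<close> separates \<open>Y\<close> from \<open>Z\<close>, then the cuts around \<open>Y\<close> and \<open>Z\<close> are
  disjoint sets of edges at \<open>x\<close>, where only three edges are available for at least six.
\<close>

lemma two_connected_underlying:
  assumes "fin_digraph D" "cut_connected 3 D" "\<forall>v\<in>verts D. card (cut D {v}) = 3"
    and big: "card (verts D) > 2"
  shows "vertex_connected 2 (underlying D)"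
  unfolding vertex_connected_def underlying_simps
proof (intro conjI allI impI)
  interpret fin_digraph D by fact
  show "2 < card (verts D)" by (rule big)
  fix X assume X: "X \<subseteq> verts D \<and> card X < 2"
  let ?H = "delete_vertices (underlying D) X"
  have H: "vertices ?H = verts D - X" "edges ?H = {e \<in> arcs D. {tail D e, head D e} \<inter> X = {}}"
    "ends ?H e = {tail D e, head D e}" for e
    by (simp_all add: delete_vertices_def underlying_def)
  have "multigraph ?H"
    unfolding multigraph_def H by (auto simp: card_insert_if)
  moreover have "verts D - X \<noteq> {}"
  proof
    assume "verts D - X = {}"
    then have "card (verts D) \<le> card X"
      using X finite_subset[of X "verts D"] by (intro card_mono) auto
    then show False using X big by linarith
  qed
  moreover have "\<exists>e\<in>edges ?H. ends ?H e \<inter> Y \<noteq> {} \<and> \<not> ends ?H e \<subseteq> Y"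
    if Y: "Y \<subseteq> verts D - X" "Y \<noteq> {}" "Y \<noteq> verts D - X" for Y
  proof (rule ccontr)
    assume no: "\<not> ?thesis"
    let ?Z = "verts D - X - Y"
    have no_edge: False if "e \<in> arcs D" "tail D e \<notin> X" "head D e \<notin> X" "(tail D e \<in> Y) \<noteq> (head D e \<in> Y)" for e
      using no that unfolding H by auto
    have Y3: "3 \<le> card (cut D Y)" and Z3: "3 \<le> card (cut D ?Z)"
      using Y by (intro cut_connectedD[OF assms(2)]; blast)+
    have key: "tail D e \<in> S \<and> head D e \<in> X \<or> tail D e \<in> X \<and> head D e \<in> S"
      if "e \<in> cut D S" "S = Y \<or> S = ?Z" for e S
    proof -
      have e: "e \<in> arcs D" "(tail D e \<in> S) \<noteq> (head D e \<in> S)" using that(1) by (auto simp: cut_def)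
      have "tail D e \<in> X \<or> head D e \<in> X"
      proof (rule ccontr)
        assume n: "\<not> ?thesis"
        then have "(tail D e \<in> Y) \<noteq> (head D e \<in> Y)"
          using e that(2) tail_in_verts[OF e(1)] head_in_verts[OF e(1)] by blast
        then show False using no_edge e(1) n by blast
      qed
      moreover have "S \<inter> X = {}" using that(2) Y(1) by blast
      ultimately show ?thesis using e(2) by blast
    qed
    have sub: "cut D Y \<union> cut D ?Z \<subseteq> {e \<in> arcs D. (tail D e \<in> X) \<noteq> (head D e \<in> X)}"
    proof
      fix e assume e: "e \<in> cut D Y \<union> cut D ?Z"
      then have "e \<in> arcs D" by (auto simp: cut_def)
      moreover have "(tail D e \<in> X) \<noteq> (head D e \<in> X)" using e key[of e] Y(1) by blast
      ultimately show "e \<in> {e \<in> arcs D. (tail D e \<in> X) \<noteq> (head D e \<in> X)}" by blast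
    qed
    have disj: "cut D Y \<inter> cut D ?Z = {}" using key Y(1) by blast
    have "card X = 0 \<or> card X = 1" using X by auto
    then show False
    proof
      assume "card X = 0"
      then have "X = {}" using X finite_subset[of X "verts D"] by auto
      then have "cut D Y = {}" using sub by auto
      then show False using Y3 by simp
    next
      assume "card X = 1"
      then obtain x where x: "X = {x}" by (rule card_1_singletonE)
      have "card (cut D Y) + card (cut D ?Z) = card (cut D Y \<union> cut D ?Z)"
        by (rule card_Un_disjoint[symmetric]) (auto simp: finite_cut disj)
      also have "\<dots> \<le> card (cut D {x})"
        by (intro card_mono finite_cut) (use sub in \<open>auto simp: x cut_def\<close>)
      also have "\<dots> = 3" using assms(3) X x by auto
      finally show False using Y3 Z3 by linarith
    qed
  qed
  ultimately show "connected_mgraph ?H"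
    by (subst connected_mgraph_iff_cuts) (auto simp: H(1))
qed

theorem theorem5p1:
  assumes "CARD('a::{finite, ab_group_add}) \<ge> 5"
    and "\<exists>G :: ('v, 'e) mgraph. multigraph G \<and> edge_connected 2 G \<and> \<not> flow_connected TYPE('a) G"
  shows "\<exists>G :: (nat, nat) mgraph. multigraph G \<and> simple_mgraph G \<and> vertex_connected 2 G \<and>
           edge_connected 3 G \<and> cubic G \<and> \<not> flow_connected TYPE('a) G"
proof -
  obtain G :: "('v, 'e) mgraph" where G: "multigraph G" "edge_connected 2 G" "\<not> flow_connected TYPE('a) G"
    using assms(2) by blast
  then obtain D where D: "orientation G D" "\<not> flow_connected_wrt TYPE('a) G D"
    by (auto simp: flow_connected_def)
  have "\<exists>D' :: ('v, 'e) pre_digraph. fin_digraph D' \<and> loopless D' \<and> cut_connected 3 D' \<and>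
      \<not> linked_flows TYPE('a) D'"
  proof (rule ex_loopless_three_cut_connected)
    show "fin_digraph D" by (rule orientation_fin_digraph[OF G(1) D(1)])
    show "cut_connected 2 D"
      using G(2) edge_connected_iff_cut_connected[OF G(1) D(1), of 2] by simp
    show "\<not> linked_flows TYPE('a) D"
      using D(2) flow_connected_wrt_iff_linked_flows[OF G(1) D(1)] by blast
  qed
  then obtain D1 :: "('v, 'e) pre_digraph" where D1: "fin_digraph D1" "loopless D1" "cut_connected 3 D1"
    "\<not> linked_flows TYPE('a) D1" by blast
  interpret D1: fin_digraph D1 by (rule D1(1))
  obtain \<kappa> :: "'v \<Rightarrow> nat" and \<iota> :: "'e \<Rightarrow> nat" where inj: "inj_on \<kappa> (verts D1)" "inj_on \<iota> (arcs D1)"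
    using finite_imp_inj_to_nat_seg[OF D1.finite_verts] finite_imp_inj_to_nat_seg[OF D1.finite_arcs]
    by blast
  note D2 = fin_digraph_rename[OF D1(1) inj] loopless_rename[OF D1(1) inj D1(2)]
    cut_connected_rename[OF D1(1) inj D1(3)]
  have "\<not> linked_flows TYPE('a) (rename_digraph \<kappa> \<iota> D1)"
    using linked_flows_rename[OF D1(1) inj] D1(4) by blast
  then obtain H :: "(nat, nat) pre_digraph" where H: "fin_digraph H" "loopless H" "cut_connected 3 H"
    "\<not> linked_flows TYPE('a) H" "2 \<le> card (verts H)" "\<forall>v\<in>verts H. card (cut H {v}) = 3"
    using ex_cubic_digraph[OF assms(1) D2] by blast
  have "card (verts H) \<noteq> 2"
  proof
    assume "card (verts H) = 2"
    then obtain u w where uw: "verts H = {u, w}" "u \<noteq> w" by (meson card_2_iff)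
    then have "card (arcs H) = 3"
      using loopless_handshake[OF H(1,2)] H(6) by simp
    then show False using linked_flows_theta[OF assms(1) H(1,2) uw(1)] H(4) by blast
  qed
  then have big: "2 < card (verts H)" using H(5) by linarith
  note mo = multigraph_underlying[OF H(1)] orientation_underlying[of H]
  have "\<not> flow_connected TYPE('a) (underlying H)"
    using H(4) flow_connected_wrt_iff_linked_flows[OF mo] mo(2) by (auto simp: flow_connected_def)
  moreover have "edge_connected 3 (underlying H)"
    using edge_connected_iff_cut_connected[OF mo, of 3] H(3) by simp
  ultimately show ?thesis
    using mo(1) cubic_underlying[OF H(2,6)] simple_underlying[OF H(1,2,3,6) big]
      two_connected_underlying[OF H(1,3,6) big] by blast
qed

end
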